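(* Let $f:X\to X$ be the one-sided full shift over an alphabet with 4 symbols. Then there exist a potential $\Phi\in C(X,\mathbb{R}^2)$, positive numbers $\epsilon_n\to0$, and a sequence of locally constant potentials $\Phi_{\epsilon_n}:X\to\mathbb{R}^2$ with $\|\Phi-\Phi_{\epsilon_n}\|_\infty<\epsilon_n$ for all $n$ (so that $\lim_{n\to\infty}\|\Phi-\Phi_{\epsilon_n}\|_\infty=0$) such that the following holds: 1. $\partial\,\mathrm{Rot}(\Phi)$ is an infinite polygon with a smooth exposed point $w_\infty$; and 2. $$0=\lim_{n\to\infty}h^l_{\Phi_{\epsilon_n}}(w_\infty,\epsilon_n)<\mathcal{H}_\Phi(w_\infty)=\lim_{n\to\infty}h^u_{\Phi_{\epsilon_n}}(w_\infty,\epsilon_n)=\log2 .$$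
   Context: $X=\{0,1,2,3\}^{\mathbb{N}}$ with the product topology and $f(\xi)_k=\xi_{k+1}$. $\mathcal{M}$ is the set of $f$-invariant Borel probability measures on $X$; $h_\mu(f)$ is the measure-theoretic entropy. For $\Psi\in C(X,\mathbb{R}^2)$, $\mathrm{rv}_\Psi(\mu)=\int\Psi\,d\mu$ (componentwise), $\mathrm{Rot}(\Psi)=\{\mathrm{rv}_\Psi(\mu):\mu\in\mathcal{M}\}$ (a compact convex set), and $\mathcal{H}_\Psi(w)=\sup\{h_\mu(f):\mu\in\mathcal{M},\ \mathrm{rv}_\Psi(\mu)=w\}$ for $w\in\mathrm{Rot}(\Psi)$. For $w_0\in\mathbb{R}^2$ and $r>0$, $$h^u_\Psi(w_0,r)=\sup\{\mathcal{H}_\Psi(w):w\in\overline{B}(w_0,r)\cap\mathrm{Rot}(\Psi)\},\qquad h^l_\Psi(w_0,r)=\inf\{\mathcal{H}_\Psi(w):w\in\overline{B}(w_0,r)\cap\mathrm{Rot}(\Psi)\},$$ with $\sup\emptyset=+\infty$, $\inf\emptyset=-\infty$. A potential is locally constant if there is $k$ such that its value at $\xi$ depends only on $\xi_1,\dots,\xi_k$. For a compact convex set $C\subset\mathbb{R}^2$: a boundary point $w$ is exposed if some supporting line of $C$ meets $C$ only at $w$, and smooth if there is exactly one supporting line of $C$ at $w$. The boundary is an infinite polygon if $C$ has infinitely many extreme points and $\partial C$ is, up to a finite set of points, a union of countably infinitely many non-degenerate line segments. *)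

theory Defs
  imports "HOL-Probability.Probability"
begin

section \<open>The one-sided full shift on four symbols\<close>

text \<open>
  The type \<open>nat \<Rightarrow> nat\<close> carries the product of the discrete topologies of
  \<open>nat\<close>, so the subspace topology of \<open>shift_space\<close> is the product topology of
  \<open>{0,1,2,3}\<close> with the discrete topology. Coordinates are numbered from \<open>0\<close>.
  Functions on \<open>shift_space\<close> are functions on the whole type of which only the
  values on \<open>shift_space\<close> are ever used.
\<close>

definition shift_space :: "(nat \<Rightarrow> nat) set" where
  "shift_space = {\<xi>. \<forall>k. \<xi> k \<in> {0, 1, 2, 3}}"

definition shift :: "(nat \<Rightarrow> nat) \<Rightarrow> (nat \<Rightarrow> nat)" where
  "shift \<xi> = (\<lambda>k. \<xi> (Suc k))"

definition invariant_measures :: "(nat \<Rightarrow> nat) measure set" where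
  "invariant_measures =
     {\<mu>. prob_space \<mu> \<and> sets \<mu> = sets (restrict_space borel shift_space) \<and>
         shift \<in> measurable \<mu> \<mu> \<and> distr \<mu> \<mu> shift = \<mu>}"

definition locally_constant :: "((nat \<Rightarrow> nat) \<Rightarrow> 'b) \<Rightarrow> bool" where
  "locally_constant \<Psi> \<longleftrightarrow>
     (\<exists>k. \<forall>\<xi>\<in>shift_space. \<forall>\<eta>\<in>shift_space. (\<forall>i<k. \<xi> i = \<eta> i) \<longrightarrow> \<Psi> \<xi> = \<Psi> \<eta>)"

definition sup_norm :: "((nat \<Rightarrow> nat) \<Rightarrow> real^2) \<Rightarrow> real" where
  "sup_norm \<Psi> = (SUP \<xi>\<in>shift_space. norm (\<Psi> \<xi>))"

section \<open>Measure-theoretic (Kolmogorov--Sinai) entropy\<close>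

definition finite_measurable_partition :: "'a measure \<Rightarrow> 'a set set \<Rightarrow> bool" where
  "finite_measurable_partition \<mu> P \<longleftrightarrow> finite P \<and> P \<subseteq> sets \<mu> \<and> partition_on (space \<mu>) P"

text \<open>Entropy uses the natural logarithm; \<open>0 * ln 0 = 0\<close> holds by convention.\<close>

definition partition_entropy :: "'a measure \<Rightarrow> 'a set set \<Rightarrow> real" where
  "partition_entropy \<mu> P = - (\<Sum>A\<in>P. measure \<mu> A * ln (measure \<mu> A))"

text \<open>The join of \<open>P\<close>, \<open>T\<close>-preimage of \<open>P\<close>, ..., \<open>T^(n-1)\<close>-preimage of \<open>P\<close>.\<close>

definition iterated_join ::
    "'a measure \<Rightarrow> ('a \<Rightarrow> 'a) \<Rightarrow> 'a set set \<Rightarrow> nat \<Rightarrow> 'a set set" where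
  "iterated_join \<mu> T P n =
     {(\<Inter>i<n. (T ^^ i) -` A i) \<inter> space \<mu> | A. \<forall>i<n. A i \<in> P} - {{}}"

definition entropy_wrt :: "'a measure \<Rightarrow> ('a \<Rightarrow> 'a) \<Rightarrow> 'a set set \<Rightarrow> real" where
  "entropy_wrt \<mu> T P = lim (\<lambda>n. partition_entropy \<mu> (iterated_join \<mu> T P n) / real n)"

definition ks_entropy :: "'a measure \<Rightarrow> ('a \<Rightarrow> 'a) \<Rightarrow> ereal" where
  "ks_entropy \<mu> T = (SUP P\<in>{P. finite_measurable_partition \<mu> P}. ereal (entropy_wrt \<mu> T P))"

section \<open>Rotation sets and localized entropy\<close>

definition rv :: "((nat \<Rightarrow> nat) \<Rightarrow> real^2) \<Rightarrow> (nat \<Rightarrow> nat) measure \<Rightarrow> real^2" where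
  "rv \<Psi> \<mu> = (\<chi> i. \<integral>\<xi>. \<Psi> \<xi> $ i \<partial>\<mu>)"

definition Rot :: "((nat \<Rightarrow> nat) \<Rightarrow> real^2) \<Rightarrow> (real^2) set" where
  "Rot \<Psi> = rv \<Psi> ` invariant_measures"

definition loc_entropy :: "((nat \<Rightarrow> nat) \<Rightarrow> real^2) \<Rightarrow> real^2 \<Rightarrow> ereal" where
  "loc_entropy \<Psi> w = (SUP \<mu>\<in>{\<mu> \<in> invariant_measures. rv \<Psi> \<mu> = w}. ks_entropy \<mu> shift)"

text \<open>
  The conventions for the empty set, \<open>+\<infinity>\<close> for the supremum and \<open>-\<infinity>\<close> for the
  infimum, are the opposite of those of the complete lattice \<open>ereal\<close>.
\<close>

definition upper_entropy :: "((nat \<Rightarrow> nat) \<Rightarrow> real^2) \<Rightarrow> real^2 \<Rightarrow> real \<Rightarrow> ereal" where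
  "upper_entropy \<Psi> w0 r =
     (if cball w0 r \<inter> Rot \<Psi> = {} then \<infinity>
      else (SUP w\<in>cball w0 r \<inter> Rot \<Psi>. loc_entropy \<Psi> w))"

definition lower_entropy :: "((nat \<Rightarrow> nat) \<Rightarrow> real^2) \<Rightarrow> real^2 \<Rightarrow> real \<Rightarrow> ereal" where
  "lower_entropy \<Psi> w0 r =
     (if cball w0 r \<inter> Rot \<Psi> = {} then -\<infinity>
      else (INF w\<in>cball w0 r \<inter> Rot \<Psi>. loc_entropy \<Psi> w))"

section \<open>Boundary structure of planar convex sets\<close>

definition supporting_line :: "(real^2) set \<Rightarrow> (real^2) set \<Rightarrow> bool" where
  "supporting_line C L \<longleftrightarrow>
     (\<exists>a b. a \<noteq> 0 \<and> L = {x. a \<bullet> x = b} \<and> C \<subseteq> {x. a \<bullet> x \<le> b} \<and> C \<inter> L \<noteq> {})"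

definition exposed_point :: "(real^2) set \<Rightarrow> real^2 \<Rightarrow> bool" where
  "exposed_point C w \<longleftrightarrow> w \<in> frontier C \<and> (\<exists>L. supporting_line C L \<and> C \<inter> L = {w})"

definition smooth_point :: "(real^2) set \<Rightarrow> real^2 \<Rightarrow> bool" where
  "smooth_point C w \<longleftrightarrow> w \<in> frontier C \<and> (\<exists>!L. supporting_line C L \<and> w \<in> L)"

text \<open>
  The segments are taken closed. As the frontier is closed, a segment that lies in
  it up to finitely many points lies in it entirely.
\<close>

definition infinite_polygon_boundary :: "(real^2) set \<Rightarrow> bool" where
  "infinite_polygon_boundary C \<longleftrightarrow>
     infinite {x. x extreme_point_of C} \<and>
     (\<exists>S. countable S \<and> infinite S \<and>
          (\<forall>s\<in>S. \<exists>a b. a \<noteq> b \<and> s = closed_segment a b) \<and>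
          \<Union>S \<subseteq> frontier C \<and> finite (frontier C - \<Union>S))"

end

theory Submission
  imports Defs
begin

text \<open>
  Let \<open>t_m = (-1/2)^m\<close> and let \<open>\<Phi> = (T, T\<^sup>2)\<close>, where \<open>T = t_m\<close> on a clopen set \<open>A_m\<close> that contains
  the periodic orbit of the word \<open>1 2^m\<close>, and \<open>T = 0\<close> off the disjoint sets \<open>A_m\<close>. Integration
  preserves the inequalities \<open>\<alpha> T + \<beta> T\<^sup>2 + \<gamma> \<ge> 0\<close>, so the rotation set is cut out by the chords
  between \<open>t_m\<close> and \<open>t_(m+2)\<close> of the parabola; their slopes have alternating signs and tend to \<open>0\<close>,
  which makes the origin a smooth exposed point.

  A measure with rotation vector near the origin gives little mass to each of \<open>A_0, ..., A_k\<close>, hence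
  little mass to the symbols \<open>0\<close> and \<open>1\<close>, and its entropy, which is at most that of the first symbol,
  hardly exceeds \<open>ln 2\<close>; the coin-tossing measure on \<open>{2,3}\<close> attains \<open>ln 2\<close> at the origin. Replacing
  \<open>T\<close> by \<open>0\<close> on \<open>A_m\<close> for \<open>m > n\<close> yields \<open>\<Phi>_n\<close>. Its vertex \<open>(t_n, t_n\<^sup>2)\<close>, which tends to the origin,
  is attained only by measures living on \<open>A_n\<close>; they are nearly concentrated on the symbol \<open>2\<close>, so
  their entropy tends to \<open>0\<close>.
\<close>

section \<open>A polygon inscribed in a parabola\<close>

text \<open>A half-plane pulled back along \<open>(T, T^2)\<close> is a quadratic inequality in
  \<open>T\<close>, so it need only be tested on the countable value set of \<open>T\<close>.
  Moreover, a rotation vector that equals a vertex of the parabola forces \<open>T\<close> to have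
  variance zero, which confines the measure to a single \<open>A_m\<close>. The main obstacle is
  that \<open>ks_entropy\<close> is a supremum over all finite partitions, while only the first
  symbol is under control. The needed half of the generator theorem comes from a coding argument: a
  long name under an arbitrary partition is coded by the symbols together with cheap corrections,
  and Gibbs' inequality turns the code into an entropy bound. The gap between the two limits is
  already present in \<open>\<Phi>\<close>: the bound at the vertices holds for it as well, so its
  localized entropy is close to 0 at vertices converging to the origin, where it is
  \<open>ln 2\<close>. Truncation retains both the vertex and the origin within the shrinking
  radius.\<close>

definition parab :: "real \<Rightarrow> real^2" where "parab t = vector [t, t\<^sup>2]"

lemma parab_nth [simp]: "parab t $ 1 = t" "parab t $ 2 = t\<^sup>2"
  by (simp_all add: parab_def)

lemma parab_0 [simp]: "parab 0 = 0"
  by (simp add: vec_eq_iff forall_2)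

lemma inner_real2: "(x :: real^2) \<bullet> y = x $ 1 * y $ 1 + x $ 2 * y $ 2"
  by (simp add: inner_vec_def sum_2)

section \<open>Nodes of alternating sign that accumulate at 0\<close>

definition node :: "nat \<Rightarrow> real" where "node m = (-1/2) ^ m"

lemma node_add_2: "node (m + 2) = node m / 4"
  by (simp add: node_def power_add)

lemma abs_node: "\<bar>node m\<bar> = (1/2) ^ m"
  by (simp add: node_def power_abs)

lemma inj_node: "inj node"
proof (rule injI)
  fix i j assume "node i = node j"
  then have "(1/2::real) ^ i = (1/2) ^ j" by (metis abs_node)
  then have "(2::real) ^ i = 2 ^ j" by (simp add: power_one_over)
  then show "i = j" by simp
qed

lemma node_even: "node (2 * k) = (1/4) ^ k"
  by (simp add: node_def power_mult power2_eq_square)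

lemma node_odd: "node (2 * k + 1) = - (1/2) * (1/4) ^ k"
  by (simp add: node_def power_mult power2_eq_square)

lemma node_0_1: "node 0 = 1" "node 1 = - 1/2" "node (Suc 0) = - 1/2"
  by (simp_all add: node_def)

lemma node_cases:
  obtains k where "m = 2 * k" "node m = (1/4) ^ k" | k where "m = 2 * k + 1" "node m = - (1/2) * (1/4) ^ k"
  by (metis evenE oddE node_even node_odd)

lemma node_bounds: "- 1/2 \<le> node m" "node m \<le> 1"
proof -
  have p: "0 \<le> (1/4::real) ^ k" "(1/4::real) ^ k \<le> 1" for k
    by (simp_all add: power_le_one)
  have "- 1/2 \<le> node m \<and> node m \<le> 1"
  proof (cases rule: node_cases[of m])
    case (1 k) show ?thesis using p[of k] unfolding 1(2) by linarith
  next
    case (2 k) show ?thesis using p[of k] unfolding 2(2) by linarith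
  qed
  then show "- 1/2 \<le> node m" "node m \<le> 1" by auto
qed

lemma power4_gap: "(1/4::real) ^ i \<le> (1/4) ^ (k + 1) \<or> (1/4) ^ k \<le> (1/4::real) ^ i"
  using power_decreasing[of i k "1/4::real"] power_decreasing[of "k + 1" i "1/4::real"] by (cases "i \<le> k") auto

text \<open>Nodes of the other sign lie on one side of both \<open>node m\<close> and
  \<open>node (m + 2)\<close>, and among nodes of the same sign these two are neighbours in a
  geometric progression of ratio 1/4. The product is the height of the parabola point over
  \<open>node j\<close> above the line through the points over \<open>node m\<close> and
  \<open>node (m + 2)\<close>.\<close>

lemma node_gap: "(node j - node m) * (node j - node (m + 2)) \<ge> 0"
proof -
  have pos: "0 < (1/4::real) ^ k" for k by simp
  have same: "((1/4) ^ i - (1/4) ^ k) * ((1/4) ^ i - (1/4) ^ k / 4) \<ge> (0::real)" for i k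
  proof (cases "(1/4) ^ k \<le> (1/4::real) ^ i")
    case True
    then show ?thesis using pos[of k] by (intro mult_nonneg_nonneg) linarith+
  next
    case False
    then show ?thesis using power4_gap[of i k] by (intro mult_nonpos_nonpos) auto
  qed
  show ?thesis
  proof (cases rule: node_cases[of m])
    case m: (1 k)
    show ?thesis
    proof (cases rule: node_cases[of j])
      case j: (1 i)
      show ?thesis unfolding node_add_2 m(2) j(2) by (rule same)
    next
      case j: (2 i)
      show ?thesis unfolding node_add_2 m(2) j(2)
        by (rule mult_nonpos_nonpos) (use pos[of i] pos[of k] in linarith)+
    qed
  next
    case m: (2 k)
    show ?thesis
    proof (cases rule: node_cases[of j])
      case j: (1 i)
      show ?thesis unfolding node_add_2 m(2) j(2)
        by (rule mult_nonneg_nonneg) (use pos[of i] pos[of k] in linarith)+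
    next
      case j: (2 i)
      show ?thesis unfolding node_add_2 m(2) j(2) using same[of i k] by (simp add: algebra_simps)
    qed
  qed
qed

lemma exists_power4_between:
  assumes "0 < x" "x \<le> (1::real)"
  obtains k where "(1/4) ^ (k + 1) \<le> x" "x \<le> (1/4) ^ k"
proof -
  have ex: "\<exists>n. (1/4) ^ n < x"
    using assms(1) real_arch_pow_inv[of x "1/4"] by auto
  define n where "n = (LEAST n. (1/4) ^ n < x)"
  have n: "(1/4) ^ n < x" unfolding n_def using ex by (rule LeastI_ex)
  with assms(2) have "n \<noteq> 0" by (intro notI) simp
  then obtain k where k: "n = Suc k" using not0_implies_Suc by blast
  have "\<not> (1/4) ^ k < x" using not_less_Least[of k "\<lambda>n. (1/4) ^ n < x"] k n_def by auto
  with n k show thesis by (intro that[of k]) auto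
qed

text \<open>Neighbouring nodes of the same sign bound intervals that cover \<open>[-1/2, 1]\<close>
  except 0. Hence each vertical line over this range, other than the one through the origin, meets a
  lower chord.\<close>

lemma exists_node_between:
  assumes "- 1/2 \<le> x" "x \<le> 1" "x \<noteq> 0"
  obtains m where "(x - node m) * (x - node (m + 2)) \<le> 0"
proof (cases "x > 0")
  case True
  then obtain k where k: "(1/4) ^ (k + 1) \<le> x" "x \<le> (1/4) ^ k"
    using exists_power4_between assms by blast
  then have "(x - node (2*k)) * (x - node (2*k + 2)) \<le> 0"
    unfolding node_add_2 by (intro mult_nonpos_nonneg) (auto simp: node_even)
  then show thesis by (rule that)
next
  case False
  with assms obtain k where k: "(1/4) ^ (k + 1) \<le> - 2 * x" "- 2 * x \<le> (1/4) ^ k"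
    using exists_power4_between[of "- 2 * x"] by force
  then have "(x - node (2*k+1)) * (x - node (2*k+1 + 2)) \<le> 0"
    unfolding node_add_2 node_odd by (intro mult_nonneg_nonpos) (auto simp: field_simps)
  then show thesis by (rule that)
qed

abbreviation nodes :: "real set" where "nodes \<equiv> insert 0 (range node)"

lemma nodes_gap: "t \<in> nodes \<Longrightarrow> (t - node m) * (t - node (m + 2)) \<ge> 0"
  using node_gap[of _ m] unfolding node_add_2 by (auto simp: algebra_simps)

lemma nodes_bounds: "t \<in> nodes \<Longrightarrow> - 1/2 \<le> t \<and> t \<le> 1"
  using node_bounds by auto

lemma node_tendsto_0: "node \<longlonglongrightarrow> 0"
  unfolding node_def by (rule LIMSEQ_power_zero) simp

lemma point_on_chord:
  assumes "p $ 2 = (s + t) * p $ 1 - s * t" "(p $ 1 - s) * (p $ 1 - t) \<le> 0" "s \<noteq> t"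
  shows "p \<in> closed_segment (parab s) (parab t)"
proof -
  define u where "u = (p $ 1 - s) / (t - s)"
  have u: "p $ 1 = s + u * (t - s)" using assms(3) by (simp add: u_def)
  have "(u * (t - s)) * ((u - 1) * (t - s)) \<le> 0" using assms(2) by (simp add: u algebra_simps)
  then have "u * (u - 1) * (t - s)\<^sup>2 \<le> 0" by (simp add: power2_eq_square mult_ac)
  moreover have "(t - s)\<^sup>2 > 0" using assms(3) by simp
  ultimately have "u * (u - 1) \<le> 0" by (simp add: mult_le_0_iff)
  then have "0 \<le> u" "u \<le> 1" by (auto simp: mult_le_0_iff)
  moreover have "p = (1 - u) *\<^sub>R parab s + u *\<^sub>R parab t"
    unfolding vec_eq_iff forall_2 using assms(1)
    by (simp add: u algebra_simps power2_eq_square)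
  ultimately show ?thesis by (auto simp: closed_segment_def)
qed

text \<open>The nodes 0 and 1 are the extreme abscissae, and their chord closes the polygon from
  above. The other chords form two chains that descend to the origin, a point that no edge
  contains.\<close>

definition edges :: "(real^2) set set" where
  "edges = insert (closed_segment (parab (node 0)) (parab (node 1)))
     (range (\<lambda>m. closed_segment (parab (node m)) (parab (node (m + 2)))))"

lemma parab_inj: "parab s = parab t \<longleftrightarrow> s = t"
  by (metis parab_nth(1))

lemma closed_segment_inj_node: "inj (\<lambda>m. closed_segment (parab (node m)) (parab (node (m + 2))))"
proof (rule injI)
  fix i j assume "closed_segment (parab (node i)) (parab (node (i + 2))) = closed_segment (parab (node j)) (parab (node (j + 2)))"
  then have "{i, i + 2} = {j, j + 2}"
    using inj_node by (auto simp: closed_segment_eq doubleton_eq_iff parab_inj inj_eq)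
  then show "i = j" by (auto simp: doubleton_eq_iff)
qed

lemma segment_linear:
  assumes "p \<in> closed_segment x y" "a \<bullet> x = b" "a \<bullet> y = b" shows "a \<bullet> p = b"
proof -
  obtain u where "p = (1 - u) *\<^sub>R x + u *\<^sub>R y" using assms(1) by (auto simp: closed_segment_def)
  then show ?thesis using assms(2,3) by (simp add: inner_add_right left_diff_distrib)
qed

text \<open>The last assumption is the dual form of \<open>C\<close> lying in the closed convex hull
  of the parabola points, and it is the form that integration delivers. As \<open>C\<close> is not
  known to be closed, frontier points are reached through \<open>closure_halfplane\<close>.\<close>

locale node_polygon =
  fixes C :: "(real^2) set"
  assumes convex: "convex C"
    and parab_in: "t \<in> nodes \<Longrightarrow> parab t \<in> C"
    and quadratic_nonneg: "\<And>p \<alpha> \<beta> \<gamma>. p \<in> C \<Longrightarrow> (\<And>t. t \<in> nodes \<Longrightarrow> \<alpha> * t + \<beta> * t\<^sup>2 + \<gamma> \<ge> 0)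
      \<Longrightarrow> \<alpha> * p $ 1 + \<beta> * p $ 2 + \<gamma> \<ge> 0"
begin

lemma zero_in: "0 \<in> C" using parab_in[of 0] by simp

text \<open>Jensen's inequality for the square, from the test quadratic
  \<open>(t - p $ 1)^2\<close>.\<close>

lemma above_parabola: assumes "p \<in> C" shows "(p $ 1)\<^sup>2 \<le> p $ 2"
proof -
  have "(- 2 * p $ 1) * p $ 1 + 1 * p $ 2 + (p $ 1)\<^sup>2 \<ge> 0"
  proof (rule quadratic_nonneg[OF assms])
    fix t
    have "(t - p $ 1)\<^sup>2 \<ge> 0" by simp
    then show "0 \<le> - 2 * p $ 1 * t + 1 * t\<^sup>2 + (p $ 1)\<^sup>2"
      by (simp add: power2_eq_square algebra_simps)
  qed
  then show ?thesis by (simp add: power2_eq_square)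
qed

lemma above_chord:
  assumes "p \<in> C" shows "p $ 2 - (node m + node (m + 2)) * p $ 1 + node m * node (m + 2) \<ge> 0"
proof -
  have "(- node m - node (m + 2)) * p $ 1 + 1 * p $ 2 + node m * node (m + 2) \<ge> 0"
    by (rule quadratic_nonneg[OF assms], drule nodes_gap[of _ m]) (simp add: algebra_simps power2_eq_square)
  then show ?thesis by (simp add: algebra_simps)
qed

lemma below_top: assumes "p \<in> C" shows "p $ 2 \<le> (p $ 1 + 1) / 2"
proof -
  have "(1/2) * p $ 1 + (-1) * p $ 2 + 1/2 \<ge> 0"
  proof (rule quadratic_nonneg[OF assms])
    fix t assume "t \<in> nodes"
    then have "0 \<le> (1 - t) * (t + 1/2)" using nodes_bounds[of t] by (intro mult_nonneg_nonneg) auto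
    then show "0 \<le> (1/2) * t + (-1) * t\<^sup>2 + 1/2" by (simp add: field_simps power2_eq_square)
  qed
  then show ?thesis by simp
qed

lemma fst_bounds: assumes "p \<in> C" shows "- 1/2 \<le> p $ 1" "p $ 1 \<le> 1"
proof -
  have "1 * p $ 1 + 0 * p $ 2 + 1/2 \<ge> 0"
    by (rule quadratic_nonneg[OF assms]) (drule nodes_bounds, simp)
  then show "- 1/2 \<le> p $ 1" by simp
  have "(-1) * p $ 1 + 0 * p $ 2 + 1 \<ge> 0"
    by (rule quadratic_nonneg[OF assms]) (drule nodes_bounds, simp)
  then show "p $ 1 \<le> 1" by simp
qed

lemma closure_halfplane:
  assumes "\<And>p. p \<in> C \<Longrightarrow> \<alpha> * p $ 1 + \<beta> * p $ 2 + \<gamma> \<ge> (0::real)" "p \<in> closure C"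
  shows "\<alpha> * p $ 1 + \<beta> * p $ 2 + \<gamma> \<ge> 0"
proof -
  have "closed {p :: real^2. \<alpha> * p $ 1 + \<beta> * p $ 2 + \<gamma> \<ge> 0}"
    by (intro closed_Collect_le continuous_intros)
  then have "closure C \<subseteq> {p. \<alpha> * p $ 1 + \<beta> * p $ 2 + \<gamma> \<ge> 0}"
    using assms(1) by (intro closure_minimal) auto
  with assms(2) show ?thesis by auto
qed

lemma frontier_supported:
  assumes "p \<in> C" "a \<noteq> 0" "\<And>q. q \<in> C \<Longrightarrow> a \<bullet> q \<le> a \<bullet> p"
  shows "p \<in> frontier C"
proof -
  have "p \<notin> interior C"
  proof
    assume "p \<in> interior C"
    then obtain e where e: "e > 0" "ball p e \<subseteq> C" by (meson mem_interior)
    let ?q = "p + (e / 2 / norm a) *\<^sub>R a"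
    have "?q \<in> ball p e" using e assms(2) by (simp add: dist_norm)
    then have "a \<bullet> ?q \<le> a \<bullet> p" using e assms(3) by blast
    then have "(e / 2 / norm a) * (a \<bullet> a) \<le> 0" by (simp add: inner_add_right)
    moreover have "(e / 2 / norm a) * (a \<bullet> a) > 0" using e assms(2) by simp
    ultimately show False by simp
  qed
  then show ?thesis using assms(1) closure_subset by (auto simp: frontier_def)
qed

lemma segment_in: "s \<in> nodes \<Longrightarrow> t \<in> nodes \<Longrightarrow> closed_segment (parab s) (parab t) \<subseteq> C"
  by (intro closed_segment_subset parab_in convex)

lemma edges_frontier: "\<Union>edges \<subseteq> frontier C"
proof -
  have "closed_segment (parab (node 0)) (parab (node 1)) \<subseteq> frontier C"
  proof
    fix p assume p: "p \<in> closed_segment (parab (node 0)) (parab (node 1))"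
    have "(vector [-1/2, 1] :: real^2) \<bullet> p = 1/2"
      by (rule segment_linear[OF p]) (simp_all add: inner_real2 node_def power2_eq_square)
    then show "p \<in> frontier C"
      using p segment_in[of "node 0" "node 1"] below_top
      by (intro frontier_supported[of p "vector [-1/2, 1]"]) (force simp: inner_real2 vec_eq_iff forall_2)+
  qed
  moreover have "closed_segment (parab (node m)) (parab (node (m + 2))) \<subseteq> frontier C" for m
  proof
    fix p assume p: "p \<in> closed_segment (parab (node m)) (parab (node (m + 2)))"
    let ?a = "vector [node m + node (m + 2), -1] :: real^2"
    have "?a \<bullet> p = node m * node (m + 2)"
      by (rule segment_linear[OF p]) (simp_all add: inner_real2 power2_eq_square algebra_simps)
    moreover have "?a \<bullet> q \<le> node m * node (m + 2)" if "q \<in> C" for q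
      using above_chord[OF that, of m] by (simp add: inner_real2)
    ultimately show "p \<in> frontier C"
      using p segment_in[of "node m" "node (m + 2)"]
      by (intro frontier_supported[of p ?a]) (force simp: vec_eq_iff forall_2)+
  qed
  ultimately show ?thesis unfolding edges_def by blast
qed

text \<open>Over each abscissa, \<open>C\<close> is bounded below by a chord, or by the origin over
  0, and above by the top edge. A frontier point strictly in between is excluded by
  \<open>vertical\<close>: vertical supporting lines occur only at the abscissae 1 and -1/2, where
  the parabola meets the top edge.\<close>

lemma frontier_edges: "frontier C \<subseteq> insert 0 (\<Union>edges)"
proof
  fix p assume pf: "p \<in> frontier C"
  then have pc: "p \<in> closure C" by (simp add: frontier_def)
  have "1 * p $ 1 + 0 * p $ 2 + 1/2 \<ge> 0" "(-1) * p $ 1 + 0 * p $ 2 + 1 \<ge> 0"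
    by (rule closure_halfplane[OF _ pc], drule fst_bounds(1), simp)
       (rule closure_halfplane[OF _ pc], drule fst_bounds(2), simp)
  then have lo: "- 1/2 \<le> p $ 1" and hi: "p $ 1 \<le> 1" by simp_all
  have "(1/2) * p $ 1 + (-1) * p $ 2 + 1/2 \<ge> 0"
    by (rule closure_halfplane[OF _ pc]) (drule below_top, simp)
  then have top: "p $ 2 \<le> (p $ 1 + 1) / 2" by simp
  have top_edge: "p \<in> \<Union>edges" if "p $ 2 = (p $ 1 + 1) / 2"
  proof -
    have "0 \<le> (1 - p $ 1) * (p $ 1 + 1/2)" using lo hi by (intro mult_nonneg_nonneg) auto
    then have "p \<in> closed_segment (parab (node 0)) (parab (node 1))"
      using that by (intro point_on_chord) (auto simp: node_def field_simps)
    then show ?thesis by (simp add: edges_def)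
  qed
  \<comment> \<open>A supporting line through a point strictly between two points of \<open>C\<close> on the same vertical is vertical.\<close>
  have vertical: "p \<in> \<Union>edges" if l: "l \<in> C" "l $ 1 = p $ 1" "l $ 2 < p $ 2" for l
  proof (rule ccontr)
    assume np: "p \<notin> \<Union>edges"
    with top top_edge have tp: "p $ 2 < (p $ 1 + 1) / 2" by fastforce
    define u :: "real^2" where "u = vector [p $ 1, (p $ 1 + 1) / 2]"
    have "0 \<le> (1 - p $ 1) * (p $ 1 + 1/2)" using lo hi by (intro mult_nonneg_nonneg) auto
    then have "u \<in> closed_segment (parab (node 0)) (parab (node 1))"
      by (intro point_on_chord) (auto simp: u_def node_def field_simps)
    then have u: "u \<in> C" using segment_in[of "node 0" "node 1"] by auto
    obtain a where a: "a \<noteq> 0" "\<And>q. q \<in> C \<Longrightarrow> a \<bullet> p \<le> a \<bullet> q"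
    proof -
      show thesis
      \<comment> \<open>The supporting hyperplane theorem concerns the relative frontier. If the
        interior is empty, a frontier point may be relatively interior, and a line containing
        \<open>C\<close> serves instead.\<close>
      proof (cases "interior C = {}")
        case True
        then obtain a b where ab: "a \<noteq> 0" "C \<subseteq> {x. a \<bullet> x = b}"
          using empty_interior_subset_hyperplane[OF convex] by blast
        then have "closure C \<subseteq> {x. a \<bullet> x = b}" by (intro closure_minimal closed_hyperplane)
        then have "a \<bullet> p = b" using pc by auto
        with ab show thesis by (intro that[of a]) auto
      next
        case False
        then have "p \<notin> rel_interior C" using pf by (simp add: frontier_def rel_interior_nonempty_interior)
        with that pc show thesis
          by (metis supporting_hyperplane_relative_frontier[OF convex] closure_subset subsetD)
      qed
    qed
    have "a $ 2 * (l $ 2 - p $ 2) \<ge> 0" "a $ 2 * (u $ 2 - p $ 2) \<ge> 0"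
      using a(2)[OF l(1)] a(2)[OF u] l(2) by (auto simp: inner_real2 u_def algebra_simps)
    then have a2: "a $ 2 = 0" using l(3) tp by (auto simp: u_def zero_le_mult_iff)
    then have a1: "a $ 1 \<noteq> 0" using a(1) by (auto simp: vec_eq_iff forall_2)
    \<comment> \<open>The vertices over 1 and -1/2 lie on the same side of the vertical line, which
      therefore passes through an extreme abscissa.\<close>
    have "a $ 1 * p $ 1 \<le> a $ 1 * 1" "a $ 1 * p $ 1 \<le> a $ 1 * (-1/2)"
      using a(2)[OF parab_in[OF insertI2[OF rangeI[of node 0]]]]
        a(2)[OF parab_in[OF insertI2[OF rangeI[of node 1]]]] a2
      by (auto simp: inner_real2 node_0_1)
    then have "p $ 1 = 1 \<or> p $ 1 = - 1/2" using a1 lo hi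
      unfolding mult_le_cancel_left by (cases "a $ 1 > 0") linarith+
    moreover have "(l $ 1)\<^sup>2 \<le> l $ 2" using above_parabola l(1) by simp
    ultimately show False using l tp by (auto simp: power2_eq_square)
  qed
  show "p \<in> insert 0 (\<Union>edges)"
  proof (cases "p $ 1 = 0")
    case True
    have "0 * p $ 1 + 1 * p $ 2 + 0 \<ge> 0"
      by (rule closure_halfplane[OF _ pc]) (use above_parabola order_trans[OF zero_le_power2] in force)
    then consider "p $ 2 = 0" | "p $ 2 > 0" by fastforce
    then show ?thesis
    proof cases
      case 1
      with True have "p = 0" unfolding vec_eq_iff forall_2 by simp
      then show ?thesis by simp
    next
      case 2
      then show ?thesis using vertical[of 0] zero_in True by simp
    qed
  next
    case False
    then obtain m where m: "(p $ 1 - node m) * (p $ 1 - node (m + 2)) \<le> 0"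
      using exists_node_between lo hi by blast
    have ne: "node m \<noteq> node (m + 2)" using inj_node by (simp add: inj_eq)
    define l :: "real^2" where "l = vector [p $ 1, (node m + node (m + 2)) * p $ 1 - node m * node (m + 2)]"
    have l1: "l $ 1 = p $ 1" by (simp add: l_def)
    have seg: "l \<in> closed_segment (parab (node m)) (parab (node (m + 2)))"
      using m ne by (intro point_on_chord) (auto simp: l_def)
    have "l \<in> C" using seg segment_in[of "node m" "node (m + 2)"] by auto
    have "- (node m + node (m + 2)) * p $ 1 + 1 * p $ 2 + node m * node (m + 2) \<ge> 0"
      by (rule closure_halfplane[OF _ pc]) (use above_chord in \<open>simp add: algebra_simps\<close>)
    then have "l $ 2 \<le> p $ 2" by (simp add: l_def algebra_simps)
    moreover have "l = p" if "l $ 2 = p $ 2"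
      using that unfolding vec_eq_iff forall_2 by (simp add: l_def)
    ultimately consider "l = p" | "l $ 2 < p $ 2" by fastforce
    then show ?thesis
    proof cases
      case 1
      have "closed_segment (parab (node m)) (parab (node (m + 2))) \<in> edges"
        unfolding edges_def by blast
      then show ?thesis using seg 1 by blast
    next
      case 2 then show ?thesis using vertical[OF \<open>l \<in> C\<close>] l1 by blast
    qed
  qed
qed

lemma extreme_parab: assumes "t \<in> nodes" shows "parab t extreme_point_of C"
  unfolding extreme_point_of_def
proof (intro conjI ballI notI)
  show "parab t \<in> C" using assms by (rule parab_in)
  fix p q assume pq: "p \<in> C" "q \<in> C" and "parab t \<in> open_segment p q"
  then obtain u where u: "p \<noteq> q" "0 < u" "u < 1" "parab t = (1 - u) *\<^sub>R p + u *\<^sub>R q"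
    by (auto simp: in_segment)
  \<comment> \<open>\<open>f\<close> is the height above the tangent of the parabola at
    \<open>t\<close>. It is nonnegative on \<open>C\<close>, so it vanishes at both ends of the
    segment, and on the tangent \<open>above_parabola\<close> leaves only the point of
    contact.\<close>
  define f where "f r = r $ 2 - 2 * t * r $ 1 + t\<^sup>2" for r :: "real^2"
  have f: "f r \<ge> (r $ 1 - t)\<^sup>2" if "r \<in> C" for r
    using above_parabola[OF that] by (simp add: f_def power2_eq_square algebra_simps)
  have "t = (1 - u) * p $ 1 + u * q $ 1" "t\<^sup>2 = (1 - u) * p $ 2 + u * q $ 2"
    using u(4) by (auto simp: vec_eq_iff forall_2)
  then have "(1 - u) * f p + u * f q = 0"
  proof -
    have "(1 - u) * f p + u * f q = ((1 - u) * p $ 2 + u * q $ 2) - 2 * t * ((1 - u) * p $ 1 + u * q $ 1) + t\<^sup>2"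
      by (simp add: f_def algebra_simps)
    also have "\<dots> = t\<^sup>2 - 2 * t * t + t\<^sup>2"
      using \<open>t = _\<close> \<open>t\<^sup>2 = _\<close> by presburger
    finally show ?thesis by (simp add: power2_eq_square)
  qed
  moreover have "f p \<ge> 0" "f q \<ge> 0" using f[OF pq(1)] f[OF pq(2)] by (meson order_trans zero_le_power2)+
  ultimately have "f p = 0" "f q = 0" using u(2,3)
    by (smt (verit) mult_pos_pos mult_nonneg_nonneg)+
  then have "p $ 1 = t" "q $ 1 = t" "p $ 2 = q $ 2" using f[OF pq(1)] f[OF pq(2)]
    by (auto simp: f_def)
  then show False using u(1) by (auto simp: vec_eq_iff forall_2)
qed

lemma polygon: "infinite_polygon_boundary C"
  unfolding infinite_polygon_boundary_def
proof (intro conjI exI[of _ edges])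
  have "inj (\<lambda>m. parab (node m))" using inj_node by (auto intro!: injI simp: parab_inj inj_eq)
  then have "infinite (range (\<lambda>m. parab (node m)))" by (rule range_inj_infinite)
  then show "infinite {x. x extreme_point_of C}"
    by (rule infinite_super[rotated]) (auto intro: extreme_parab)
  show "countable edges" by (simp add: edges_def)
  show "infinite edges" unfolding edges_def
    by (rule infinite_super[OF subset_insertI range_inj_infinite[OF closed_segment_inj_node]])
  show "\<forall>s\<in>edges. \<exists>a b. a \<noteq> b \<and> s = closed_segment a b"
  proof
    fix s assume "s \<in> edges"
    then obtain i j where "i \<noteq> j" "s = closed_segment (parab (node i)) (parab (node j))"
    proof (cases "s = closed_segment (parab (node 0)) (parab (node 1))")
      case True then show thesis by (intro that[of 0 1]) auto
    next
      case False
      with \<open>s \<in> edges\<close> obtain m where "s = closed_segment (parab (node m)) (parab (node (m + 2)))"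
        unfolding edges_def by blast
      then show thesis by (intro that[of m "m + 2"]) auto
    qed
    then show "\<exists>a b. a \<noteq> b \<and> s = closed_segment a b" by (metis parab_inj inj_node injD)
  qed
  show "\<Union>edges \<subseteq> frontier C" by (rule edges_frontier)
  have "frontier C - \<Union>edges \<subseteq> {0}" using frontier_edges by auto
  then show "finite (frontier C - \<Union>edges)" using finite_subset by blast
qed

lemma zero_line:
  "supporting_line C {x. vector [0, -1] \<bullet> x = (0::real)}" (is "supporting_line C ?L")
  "C \<inter> {x. vector [0, -1] \<bullet> x = (0::real)} = {0}"
proof -
  have nn: "p $ 2 \<ge> 0" if "p \<in> C" for p
    using above_parabola[OF that] by (meson order_trans zero_le_power2)
  show "C \<inter> ?L = {0}"
    using zero_in above_parabola by (force simp: inner_real2 vec_eq_iff forall_2)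
  then show "supporting_line C ?L" unfolding supporting_line_def using nn
    by (intro exI[of _ "vector [0, -1]"] exI[of _ 0]) (auto simp: inner_real2 vec_eq_iff forall_2)
qed

lemma zero_frontier: "0 \<in> frontier C"
proof (rule frontier_supported[of 0 "vector [0, -1]"])
  show "vector [0, -1] \<bullet> q \<le> vector [0, -1] \<bullet> (0 :: real^2)" if "q \<in> C" for q
    using above_parabola[OF that] order_trans[OF zero_le_power2] by (auto simp: inner_real2)
qed (auto simp: zero_in vec_eq_iff forall_2)

lemma zero_exposed: "exposed_point C 0"
  unfolding exposed_point_def using zero_frontier zero_line by blast

text \<open>Dividing the supporting inequality at a node by that node, positive for even and
  negative for odd index, yields opposite inequalities. As the nodes tend to 0, the first coordinate
  of the normal must vanish.\<close>

lemma zero_smooth: "smooth_point C 0"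
  unfolding smooth_point_def
proof (intro conjI ex1I)
  let ?L = "{x :: real^2. vector [0, -1] \<bullet> x = 0}"
  show "0 \<in> frontier C" by (rule zero_frontier)
  show "supporting_line C ?L" by (rule zero_line)
  show "0 \<in> ?L" by simp
  fix L assume "supporting_line C L \<and> 0 \<in> L"
  then obtain a where a: "a \<noteq> 0" "L = {x. a \<bullet> x = 0}" "\<And>x. x \<in> C \<Longrightarrow> a \<bullet> x \<le> 0"
  proof -
    from \<open>supporting_line C L \<and> 0 \<in> L\<close> obtain a b where
      "a \<noteq> 0" "L = {x. a \<bullet> x = b}" "C \<subseteq> {x. a \<bullet> x \<le> b}" "0 \<in> L"
      unfolding supporting_line_def by blast
    then show thesis by (intro that[of a]) auto
  qed
  have le: "a $ 1 * node m + a $ 2 * (node m)\<^sup>2 \<le> 0" for m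
    using a(3)[OF parab_in[of "node m"]] by (simp add: inner_real2)
  have lim: "(\<lambda>k. a $ 1 + a $ 2 * node (f k)) \<longlonglongrightarrow> a $ 1" if "strict_mono f" for f
  proof -
    have "(\<lambda>k. node (f k)) \<longlonglongrightarrow> 0"
      using LIMSEQ_subseq_LIMSEQ[OF node_tendsto_0 that] by (simp add: o_def)
    from tendsto_add[OF tendsto_const tendsto_mult_right_zero[OF this, of "a $ 2"], of "a $ 1"]
    show ?thesis by simp
  qed
  have "a $ 1 \<le> 0"
  proof (rule LIMSEQ_le_const2[OF lim[of "\<lambda>k. 2 * k"]])
    have "a $ 1 + a $ 2 * node (2 * k) \<le> 0" for k
    proof -
      have "node (2 * k) * (a $ 1 + a $ 2 * node (2 * k)) \<le> 0"
        using le[of "2 * k"] by (simp add: power2_eq_square algebra_simps)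
      moreover have "node (2 * k) > 0" by (simp add: node_even)
      ultimately show ?thesis by (simp add: mult_le_0_iff)
    qed
    then show "\<exists>N. \<forall>k\<ge>N. a $ 1 + a $ 2 * node (2 * k) \<le> 0" by blast
  qed (auto simp: strict_mono_def)
  moreover have "a $ 1 \<ge> 0"
  proof (rule LIMSEQ_le_const[OF lim[of "\<lambda>k. 2 * k + 1"]])
    have "a $ 1 + a $ 2 * node (2 * k + 1) \<ge> 0" for k
    proof -
      have "node (2 * k + 1) * (a $ 1 + a $ 2 * node (2 * k + 1)) \<le> 0"
        using le[of "2 * k + 1"] by (simp add: power2_eq_square algebra_simps)
      moreover have "node (2 * k + 1) < 0" by (simp only: node_odd) simp
      ultimately show ?thesis by (auto simp: mult_le_0_iff)
    qed
    then show "\<exists>N. \<forall>k\<ge>N. 0 \<le> a $ 1 + a $ 2 * node (2 * k + 1)" by blast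
  qed (auto simp: strict_mono_def)
  ultimately have "a $ 1 = 0" by simp
  with a(1) have "a $ 2 \<noteq> 0" unfolding vec_eq_iff forall_2 by simp
  then have "a \<bullet> x = 0 \<longleftrightarrow> vector [0, -1] \<bullet> x = 0" for x
    by (simp add: inner_real2 \<open>a $ 1 = 0\<close>)
  then show "L = ?L" unfolding a(2) by (rule Collect_cong)
qed

end

section \<open>Entropy of finite-valued random variables\<close>

definition law :: "'a measure \<Rightarrow> ('a \<Rightarrow> 'b) \<Rightarrow> 'b \<Rightarrow> real" where
  "law M Z z = measure M (Z -` {z} \<inter> space M)"

text \<open>Replacing partitions by finite-valued variables turns an iterated join into a single
  variable, the itinerary, whose values can be summed over. Taking only attained values avoids empty
  cells.\<close>

definition fibres :: "'a measure \<Rightarrow> ('a \<Rightarrow> 'b) \<Rightarrow> 'a set set" where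
  "fibres M Z = (\<lambda>z. Z -` {z} \<inter> space M) ` Z ` space M"

definition ent :: "'a measure \<Rightarrow> ('a \<Rightarrow> 'b) \<Rightarrow> real" where
  "ent M Z = - (\<Sum>z\<in>Z ` space M. law M Z z * ln (law M Z z))"

lemma partition_entropy_fibres: "partition_entropy M (fibres M Z) = ent M Z"
proof -
  have "inj_on (\<lambda>z. Z -` {z} \<inter> space M) (Z ` space M)"
    by (rule inj_onI) blast
  then show ?thesis
    by (simp add: partition_entropy_def ent_def fibres_def law_def sum.reindex)
qed

lemma finite_measurable_partition_fibres:
  assumes "simple_function M X" shows "finite_measurable_partition M (fibres M X)"
  using assms unfolding finite_measurable_partition_def fibres_def simple_function_def partition_on_def
  by (auto simp: disjoint_def)

lemma partition_eq_fibres: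
  assumes "finite_measurable_partition M P"
  obtains X :: "'a \<Rightarrow> 'a set" where "simple_function M X" "fibres M X = P"
proof -
  have P: "finite P" "P \<subseteq> sets M" "\<Union>P = space M" "{} \<notin> P" "disjoint P"
    using assms by (auto simp: finite_measurable_partition_def partition_on_def)
  define X where "X \<omega> = (THE A. A \<in> P \<and> \<omega> \<in> A)" for \<omega>
  have X: "X \<omega> = A" if "A \<in> P" "\<omega> \<in> A" for \<omega> A
    unfolding X_def using that P(5) by (intro the_equality) (auto dest: disjointD)
  have img: "X ` space M = P"
  proof
    show "X ` space M \<subseteq> P" using P(3) X by blast
    show "P \<subseteq> X ` space M"
    proof
      fix A assume A: "A \<in> P"
      then obtain \<omega> where "\<omega> \<in> A" using P(4) by (metis all_not_in_conv)
      then show "A \<in> X ` space M" using X[OF A] A P(3) by blast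
    qed
  qed
  have fib: "X -` {A} \<inter> space M = A" if "A \<in> P" for A
    using X P(3) that by blast
  show thesis
  proof (rule that)
    show "simple_function M X" unfolding simple_function_def img using P fib by auto
    show "fibres M X = P" unfolding fibres_def img using fib by simp
  qed
qed

context prob_space begin

lemma law_nonneg [simp]: "law M Z z \<ge> 0" by (simp add: law_def)

lemma law_le_1 [simp]: "law M Z z \<le> 1" by (simp add: law_def)

lemma expectation_simple:
  assumes "simple_function M Z"
  shows "expectation (\<lambda>\<omega>. g (Z \<omega>)) = (\<Sum>z\<in>Z ` space M. law M Z z * (g z :: real))"
    and "integrable M (\<lambda>\<omega>. g (Z \<omega>))"
proof -
  let ?f = "\<lambda>\<omega>. \<Sum>z\<in>Z ` space M. g z * indicator (Z -` {z} \<inter> space M) \<omega>"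
  have fin: "finite (Z ` space M)" using assms by (simp add: simple_function_def)
  have meas: "Z -` {z} \<inter> space M \<in> events" for z using assms by (rule simple_functionD)
  have eq: "g (Z \<omega>) = ?f \<omega>" if "\<omega> \<in> space M" for \<omega>
  proof -
    have "?f \<omega> = (\<Sum>z\<in>Z ` space M. if z = Z \<omega> then g z else 0)"
      using that by (intro sum.cong) (auto simp: indicator_def)
    then show ?thesis using fin that by simp
  qed
  have int: "integrable M (\<lambda>\<omega>. g z * indicator (Z -` {z} \<inter> space M) \<omega>)" for z
    using meas by (intro integrable_mult_right integrable_real_indicator) (auto simp: less_top[symmetric])
  show "expectation (\<lambda>\<omega>. g (Z \<omega>)) = (\<Sum>z\<in>Z ` space M. law M Z z * g z)"
  proof -
    have "expectation (\<lambda>\<omega>. g (Z \<omega>)) = expectation ?f"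
      by (rule Bochner_Integration.integral_cong) (use eq in auto)
    also have "\<dots> = (\<Sum>z\<in>Z ` space M. expectation (\<lambda>\<omega>. g z * indicator (Z -` {z} \<inter> space M) \<omega>))"
      by (rule Bochner_Integration.integral_sum) (rule int)
    also have "\<dots> = (\<Sum>z\<in>Z ` space M. law M Z z * g z)"
      by (intro sum.cong) (simp_all add: law_def mult.commute)
    finally show ?thesis .
  qed
  show "integrable M (\<lambda>\<omega>. g (Z \<omega>))"
    by (subst Bochner_Integration.integrable_cong[OF refl eq]) (auto intro: int)
qed

lemma sum_law: "simple_function M Z \<Longrightarrow> (\<Sum>z\<in>Z ` space M. law M Z z) = 1"
  using expectation_simple(1)[of Z "\<lambda>_. 1"] by (simp add: prob_space)

lemma ent_eq_expectation: "simple_function M Z \<Longrightarrow> ent M Z = expectation (\<lambda>\<omega>. - ln (law M Z (Z \<omega>)))"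
  using expectation_simple(1)[of Z "\<lambda>z. - ln (law M Z z)"] by (simp only: ent_def) (simp add: sum_negf)

text \<open>Since \<open>ln 0 = 0\<close> by default, the logarithm of a product of laws splits only
  where the factors are positive; this makes that so almost everywhere.\<close>

lemma AE_law_pos:
  assumes "simple_function M Z" shows "AE \<omega> in M. law M Z (Z \<omega>) > 0"
proof -
  have "AE \<omega> in M. \<forall>z\<in>Z ` space M. law M Z z = 0 \<longrightarrow> Z \<omega> \<noteq> z"
  proof (rule AE_finite_allI)
    show "finite (Z ` space M)" using assms by (simp add: simple_function_def)
    fix z
    have m: "Z -` {z} \<inter> space M \<in> events" using assms by (rule simple_functionD)
    show "AE \<omega> in M. law M Z z = 0 \<longrightarrow> Z \<omega> \<noteq> z"
    proof (cases "law M Z z = 0")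
      case True
      then have "Z -` {z} \<inter> space M \<in> null_sets M"
        using m by (simp add: null_sets_def law_def emeasure_eq_measure)
      then show ?thesis by (rule AE_I') auto
    qed simp
  qed
  with AE_space show ?thesis
    by eventually_elim (metis imageI law_nonneg order_le_less)
qed

text \<open>
  Gibbs' inequality. Passing to the coarser variable \<open>f W\<close> on the left costs nothing, since the proof
  only uses that the law of \<open>W\<close> at \<open>w\<close> is at most the law of \<open>f W\<close> at \<open>f w\<close>.
\<close>

lemma ent_le_cross_entropy:
  assumes W: "simple_function M W"
    and q: "\<And>w. w \<in> W ` space M \<Longrightarrow> q w \<ge> 0" "(\<Sum>w\<in>W ` space M. q w) \<le> 1" "AE \<omega> in M. q (W \<omega>) > 0"
  shows "ent M (\<lambda>\<omega>. f (W \<omega>)) \<le> expectation (\<lambda>\<omega>. - ln (q (W \<omega>)))"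
proof -
  let ?Z = "\<lambda>\<omega>. f (W \<omega>)" and ?p = "law M W"
  have Z: "simple_function M ?Z" using simple_function_compose1[OF W, of f] by simp
  let ?P = "\<lambda>w. law M ?Z (f w)"
  have fin: "finite (W ` space M)" using W by (simp add: simple_function_def)
  have pP: "?p w \<le> ?P w" for w
    unfolding law_def using simple_functionD(2)[OF Z] by (intro finite_measure_mono) auto
  have pos: "q w > 0" if "?p w > 0" for w
  proof (rule ccontr)
    assume "\<not> q w > 0"
    have "AE \<omega> in M. W \<omega> \<noteq> w" using q(3) by eventually_elim (use \<open>\<not> q w > 0\<close> in auto)
    then have "?p w = 0" unfolding law_def
      using simple_functionD(2)[OF W, of "{w}"] by (subst prob_eq_0) (auto elim: eventually_mono)
    with that show False by simp
  qed
  have "ent M ?Z = (\<Sum>w\<in>W ` space M. ?p w * (- ln (?P w)))"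
    unfolding ent_eq_expectation[OF Z] by (rule expectation_simple(1)[OF W])
  \<comment> \<open>The added terms \<open>q w - ?p w\<close> sum to at most 0, because
    \<open>q\<close> has total mass at most 1.\<close>
  also have "\<dots> \<le> (\<Sum>w\<in>W ` space M. ?p w * (- ln (q w)) + (q w - ?p w))"
  proof (rule sum_mono)
    fix w assume w: "w \<in> W ` space M"
    show "?p w * (- ln (?P w)) \<le> ?p w * (- ln (q w)) + (q w - ?p w)"
    proof (cases "?p w = 0")
      case True then show ?thesis using q(1)[OF w] by simp
    next
      case False
      then have p: "?p w > 0" by (simp add: less_le)
      note P = less_le_trans[OF p pP]
      have "ln (q w / ?P w) \<le> q w / ?P w - 1" using pos[OF p] P by (intro ln_le_minus_one) simp
      then have "- ln (?P w) \<le> - ln (q w) + (q w / ?P w - 1)"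
        using pos[OF p] P by (simp add: ln_div)
      then have "?p w * (- ln (?P w)) \<le> ?p w * (- ln (q w) + (q w / ?P w - 1))"
        using p by (intro mult_left_mono) auto
      also have "?p w * (q w / ?P w) \<le> q w"
        using pP[of w] P pos[OF p] by (simp add: field_simps)
      then have "?p w * (- ln (q w) + (q w / ?P w - 1)) \<le> ?p w * (- ln (q w)) + (q w - ?p w)"
        by (simp add: algebra_simps)
      finally show ?thesis .
    qed
  qed
  also have "\<dots> = (\<Sum>w\<in>W ` space M. ?p w * (- ln (q w))) + ((\<Sum>w\<in>W ` space M. q w) - 1)"
    by (simp add: sum.distrib sum_subtractf sum_negf sum_law[OF W])
  also have "\<dots> \<le> expectation (\<lambda>\<omega>. - ln (q (W \<omega>)))"
    using q(2) expectation_simple(1)[OF W, of "\<lambda>w. - ln (q w)"] by linarith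
  finally show ?thesis .
qed

lemma ent_nonneg: "ent M Z \<ge> 0"
proof -
  have "ln (law M Z z) \<le> 0" for z
    by (cases "law M Z z = 0") (simp_all add: less_le)
  then show ?thesis
    unfolding ent_def neg_0_le_iff_le by (intro sum_nonpos mult_nonneg_nonpos) simp_all
qed

end

section \<open>Names along an orbit and their entropy rate\<close>

definition itinerary :: "('a \<Rightarrow> 'b) \<Rightarrow> ('a \<Rightarrow> 'a) \<Rightarrow> nat \<Rightarrow> 'a \<Rightarrow> nat \<Rightarrow> 'b" where
  "itinerary X T n \<omega> = (\<lambda>i\<in>{..<n}. X ((T ^^ i) \<omega>))"

lemma itinerary_nth [simp]: "i < n \<Longrightarrow> itinerary X T n \<omega> i = X ((T ^^ i) \<omega>)"
  by (simp add: itinerary_def)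

lemma itinerary_eq_iff: "itinerary X T n \<omega> = itinerary X T n \<omega>' \<longleftrightarrow> (\<forall>i<n. X ((T ^^ i) \<omega>) = X ((T ^^ i) \<omega>'))"
  by (auto simp: itinerary_def restrict_def fun_eq_iff)

text \<open>A nonempty cell of the join is determined by the itinerary of any of its points.
  Deleting \<open>{}\<close> from the join matches the fact that \<open>fibres\<close> uses only
  names of actual points.\<close>

lemma iterated_join_fibres:
  assumes "\<And>i \<omega>. \<omega> \<in> space M \<Longrightarrow> (T ^^ i) \<omega> \<in> space M"
  shows "iterated_join M T (fibres M X) n = fibres M (itinerary X T n)"
proof (intro set_eqI iffI)
  fix B assume "B \<in> iterated_join M T (fibres M X) n"
  then obtain A where A: "B = (\<Inter>i<n. (T ^^ i) -` A i) \<inter> space M" "\<forall>i<n. A i \<in> fibres M X" "B \<noteq> {}"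
    by (auto simp: iterated_join_def)
  then obtain \<omega> where \<omega>: "\<omega> \<in> B" by auto
  have Ai: "A i = X -` {X ((T ^^ i) \<omega>)} \<inter> space M" if i: "i < n" for i
  proof -
    obtain z where "A i = X -` {z} \<inter> space M" using A(2) i unfolding fibres_def by blast
    moreover have "(T ^^ i) \<omega> \<in> A i" using A(1) \<omega> i by blast
    ultimately show ?thesis by simp
  qed
  then have "B = itinerary X T n -` {itinerary X T n \<omega>} \<inter> space M"
    unfolding A(1) using assms by (auto simp: itinerary_eq_iff Ai)
  then show "B \<in> fibres M (itinerary X T n)" using \<omega> A(1) by (auto simp: fibres_def)
next
  fix B assume "B \<in> fibres M (itinerary X T n)"
  then obtain \<omega> where \<omega>: "\<omega> \<in> space M" "B = itinerary X T n -` {itinerary X T n \<omega>} \<inter> space M"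
    by (auto simp: fibres_def)
  define A where "A i = X -` {X ((T ^^ i) \<omega>)} \<inter> space M" for i
  have "B = (\<Inter>i<n. (T ^^ i) -` A i) \<inter> space M"
    using \<omega> assms by (auto simp: itinerary_eq_iff A_def)
  moreover have "\<forall>i<n. A i \<in> fibres M X" using \<omega>(1) assms by (auto simp: A_def fibres_def)
  moreover have "B \<noteq> {}" using \<omega> by auto
  ultimately show "B \<in> iterated_join M T (fibres M X) n"
    unfolding iterated_join_def by blast
qed

text \<open>\<open>entropy_wrt\<close> is a \<open>lim\<close>, which says nothing about a divergent
  sequence, so convergence has to be known before any bound on it. Division with remainder by an
  \<open>m\<close> whose quotient is almost the infimum leaves a bounded error.\<close>

lemma fekete:
  fixes a :: "nat \<Rightarrow> real"
  assumes nonneg: "\<And>n. a n \<ge> 0" and sub: "\<And>m n. a (m + n) \<le> a m + a n"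
  shows "convergent (\<lambda>n. a n / real n)"
proof -
  define L where "L = (INF n\<in>{1..}. a n / real n)"
  have bdd: "bdd_below ((\<lambda>n. a n / real n) ` {1..})"
    using nonneg by (intro bdd_belowI[of _ 0]) auto
  have mult: "a (q * m + r) \<le> real q * a m + a r" for q m r
  proof (induction q)
    case (Suc q)
    have "a (Suc q * m + r) \<le> a m + a (q * m + r)" using sub[of m "q * m + r"] by (simp add: algebra_simps)
    with Suc show ?case by (simp add: algebra_simps)
  qed simp
  have "(\<lambda>n. a n / real n) \<longlonglongrightarrow> L"
  proof (rule LIMSEQ_I)
    fix e :: real assume e: "e > 0"
    then obtain m where m: "m \<ge> 1" "a m / real m < L + e / 2"
      using cINF_less_iff[OF _ bdd, of "L + e / 2"] unfolding L_def by force
    define B where "B = (\<Sum>r<m. a r)"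
    have B: "a r \<le> B" if "r < m" for r
      unfolding B_def using that nonneg by (intro member_le_sum) auto
    obtain N where N: "N \<ge> 1" "2 * B / e < real N"
      using reals_Archimedean2[of "max 1 (2 * B / e)"] by (metis One_nat_def Suc_leI less_max_iff_disj max_less_iff_conj of_nat_0_less_iff order_less_trans zero_less_one)
    have "norm (a n / real n - L) < e" if n: "n \<ge> N" for n
    proof -
      have n0: "real n > 0" using n N by simp
      have "a n \<le> real (n div m) * a m + a (n mod m)" using mult[of "n div m" m "n mod m"] by simp
      also have "\<dots> \<le> real n / real m * a m + B"
        using m nonneg B[of "n mod m"] by (intro add_mono mult_right_mono of_nat_div_le_of_nat) auto
      finally have "a n / real n \<le> (real n / real m * a m + B) / real n"
        using n0 by (intro divide_right_mono) auto
      also have "\<dots> = a m / real m + B / real n" using n0 by (simp add: field_simps)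
      also have "B / real n < e / 2"
      proof -
        have "2 * B / e < real n" using N(2) n by simp
        then show ?thesis using e n0 by (simp add: field_simps)
      qed
      finally have "a n / real n < L + e" using m(2) by simp
      moreover have "L \<le> a n / real n" unfolding L_def
        using n N by (intro cINF_lower[OF bdd]) auto
      ultimately show ?thesis by simp
    qed
    then show "\<exists>N. \<forall>n\<ge>N. norm (a n / real n - L) < e" by blast
  qed
  then show ?thesis by (auto simp: convergent_def)
qed

locale measure_preserving_system = prob_space M for M :: "'a measure" +
  fixes T :: "'a \<Rightarrow> 'a"
  assumes T_measurable: "T \<in> measurable M M" and T_distr: "distr M M T = M"
begin

lemma funpow_measurable: "T ^^ i \<in> measurable M M"
  using T_measurable by (induction i) (auto intro: measurable_compose simp: comp_def)

lemma funpow_distr: "distr M M (T ^^ i) = M"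
proof (induction i)
  case 0 show ?case by (simp add: id_def distr_id)
next
  case (Suc i)
  have "distr M M (T ^^ Suc i) = distr (distr M M (T ^^ i)) M T"
    by (simp add: distr_distr[OF T_measurable funpow_measurable] comp_def)
  then show ?case by (simp only: Suc T_distr)
qed

lemma funpow_space: "\<omega> \<in> space M \<Longrightarrow> (T ^^ i) \<omega> \<in> space M"
  using funpow_measurable by (rule measurable_space)

lemma measure_funpow: "A \<in> events \<Longrightarrow> measure M ((T ^^ i) -` A \<inter> space M) = measure M A"
  using measure_distr[OF funpow_measurable, of A i] by (simp add: funpow_distr)

lemma simple_funpow: assumes "simple_function M X" shows "simple_function M (\<lambda>\<omega>. X ((T ^^ i) \<omega>))"
  by (rule simple_function_comp[OF funpow_measurable assms, simplified comp_def])

lemma law_funpow: assumes "simple_function M X" shows "law M (\<lambda>\<omega>. X ((T ^^ i) \<omega>)) = law M X"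
proof
  fix z
  have "(\<lambda>\<omega>. X ((T ^^ i) \<omega>)) -` {z} \<inter> space M = (T ^^ i) -` (X -` {z} \<inter> space M) \<inter> space M"
    using funpow_space by auto
  then show "law M (\<lambda>\<omega>. X ((T ^^ i) \<omega>)) z = law M X z"
    unfolding law_def using measure_funpow[OF simple_functionD(2)[OF assms, of "{z}"]] by simp
qed

lemma expectation_funpow:
  assumes X: "simple_function M X"
  shows "expectation (\<lambda>\<omega>. g (X ((T ^^ i) \<omega>))) = expectation (\<lambda>\<omega>. g (X \<omega>) :: real)"
proof -
  have "(\<lambda>\<omega>. g (X \<omega>)) \<in> borel_measurable M" using expectation_simple(2)[OF X] by blast
  from integral_distr[OF funpow_measurable this, of i] show ?thesis by (simp add: funpow_distr)
qed

lemma simple_itinerary: assumes X: "simple_function M X" shows "simple_function M (itinerary X T n)"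
  unfolding simple_function_def
proof (intro conjI ballI)
  have "itinerary X T n ` space M \<subseteq> {..<n} \<rightarrow>\<^sub>E X ` space M"
    using funpow_space by (auto simp: itinerary_def PiE_def extensional_def)
  moreover have "finite (X ` space M)" using X by (simp add: simple_function_def)
  ultimately show "finite (itinerary X T n ` space M)" by (meson finite_PiE finite_lessThan finite_subset)
  fix z assume "z \<in> itinerary X T n ` space M"
  then obtain \<omega> where "z = itinerary X T n \<omega>" by blast
  then have "itinerary X T n -` {z} \<inter> space M = {\<omega>'\<in>space M. \<forall>i\<in>{..<n}. X ((T ^^ i) \<omega>') \<in> {z i}}"
    by (auto simp: itinerary_eq_iff)
  also have "\<dots> \<in> events"
  proof (rule sets.sets_Collect_finite_All)
    show "{\<omega>'\<in>space M. X ((T ^^ i) \<omega>') \<in> {z i}} \<in> events" for i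
      using simple_functionD(2)[OF simple_funpow[OF X], of i "{z i}"] by (simp add: vimage_def Int_def conj_commute)
  qed simp
  finally show "itinerary X T n -` {z} \<inter> space M \<in> events" .
qed

text \<open>Gibbs' inequality against the product of the laws of the first \<open>n\<close> and the
  last \<open>m\<close> labels; by invariance the last \<open>m\<close> labels are distributed like
  an itinerary of length \<open>m\<close>.\<close>

lemma ent_itinerary_subadditive:
  assumes X: "simple_function M X"
  shows "ent M (itinerary X T (n + m)) \<le> ent M (itinerary X T n) + ent M (itinerary X T m)"
proof -
  let ?I = "\<lambda>n. itinerary X T n"
  define hd where "hd l = restrict l {..<n}" for l :: "nat \<Rightarrow> 'b"
  define tl where "tl l = restrict (\<lambda>i. l (n + i)) {..<m}" for l :: "nat \<Rightarrow> 'b"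
  have hd: "hd (?I (n + m) \<omega>) = ?I n \<omega>" for \<omega> by (auto simp: hd_def itinerary_def)
  have tl: "tl (?I (n + m) \<omega>) = ?I m ((T ^^ n) \<omega>)" for \<omega>
    by (auto simp: tl_def itinerary_def restrict_def fun_eq_iff add.commute funpow_add)
  define q where "q l = law M (?I n) (hd l) * law M (?I m) (tl l)" for l
  have S: "simple_function M (?I k)" for k using X by (rule simple_itinerary)
  have "ent M (\<lambda>\<omega>. id (?I (n + m) \<omega>)) \<le> expectation (\<lambda>\<omega>. - ln (q (?I (n + m) \<omega>)))"
  proof (rule ent_le_cross_entropy[OF S])
    show "q w \<ge> 0" for w by (simp add: q_def)
    let ?R = "\<lambda>k. ?I k ` space M"
    have fin: "finite (?R k)" for k using S by (simp add: simple_function_def)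
    \<comment> \<open>A word is recovered from its two halves, so the sum of \<open>q\<close> is at
      most the product of two total masses.\<close>
    have inj: "inj_on (\<lambda>l. (hd l, tl l)) (?R (n + m))"
    proof (rule inj_onI)
      fix l l' assume "l \<in> ?R (n + m)" "l' \<in> ?R (n + m)" and eq: "(hd l, tl l) = (hd l', tl l')"
      then obtain \<omega> \<omega>' where l: "l = ?I (n + m) \<omega>" "l' = ?I (n + m) \<omega>'" by blast
      have "X ((T ^^ i) \<omega>) = X ((T ^^ i) \<omega>')" if "i < n + m" for i
      proof (cases "i < n")
        case True
        then show ?thesis using eq by (simp add: l hd itinerary_eq_iff)
      next
        case False
        then have "X ((T ^^ (i - n)) ((T ^^ n) \<omega>)) = X ((T ^^ (i - n)) ((T ^^ n) \<omega>'))"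
          using eq that by (simp add: l tl itinerary_eq_iff)
        with False show ?thesis by (metis comp_apply funpow_add le_add_diff_inverse2 not_le)
      qed
      then show "l = l'" by (simp add: l itinerary_eq_iff)
    qed
    have "(\<Sum>l\<in>?R (n + m). q l) = (\<Sum>(u, v)\<in>(\<lambda>l. (hd l, tl l)) ` ?R (n + m). law M (?I n) u * law M (?I m) v)"
      by (simp add: sum.reindex[OF inj] q_def)
    also have "\<dots> \<le> (\<Sum>(u, v)\<in>?R n \<times> ?R m. law M (?I n) u * law M (?I m) v)"
      using fin hd tl funpow_space by (intro sum_mono2) auto
    also have "\<dots> = (\<Sum>u\<in>?R n. law M (?I n) u) * (\<Sum>v\<in>?R m. law M (?I m) v)"
      by (simp add: sum_product sum.cartesian_product)
    also have "\<dots> = 1" by (simp add: sum_law S)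
    finally show "(\<Sum>l\<in>?R (n + m). q l) \<le> 1" .
    show "AE \<omega> in M. q (?I (n + m) \<omega>) > 0"
      using AE_law_pos[OF S[of n]] AE_law_pos[OF simple_funpow[OF S, of m n]]
      by eventually_elim (simp add: q_def hd tl law_funpow[OF S])
  qed
  also have "\<dots> = expectation (\<lambda>\<omega>. - ln (law M (?I n) (?I n \<omega>)) + - ln (law M (?I m) (?I m ((T ^^ n) \<omega>))))"
  proof (rule integral_cong_AE)
    show "AE \<omega> in M. - ln (q (?I (n + m) \<omega>)) = - ln (law M (?I n) (?I n \<omega>)) + - ln (law M (?I m) (?I m ((T ^^ n) \<omega>)))"
      using AE_law_pos[OF S[of n]] AE_law_pos[OF simple_funpow[OF S, of m n]]
      by eventually_elim (simp add: q_def hd tl law_funpow[OF S] ln_mult)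
    show "(\<lambda>\<omega>. - ln (q (?I (n + m) \<omega>))) \<in> borel_measurable M"
      using expectation_simple(2)[OF S, of "\<lambda>l. - ln (q l)"] by blast
    show "(\<lambda>\<omega>. - ln (law M (?I n) (?I n \<omega>)) + - ln (law M (?I m) (?I m ((T ^^ n) \<omega>)))) \<in> borel_measurable M"
      using expectation_simple(2)[OF S, of "\<lambda>l. - ln (law M (?I n) l)"]
        expectation_simple(2)[OF simple_funpow[OF S], of "\<lambda>l. - ln (law M (?I m) l)"]
      by (intro borel_measurable_add) blast+
  qed
  also have "\<dots> = ent M (?I n) + ent M (?I m)"
    unfolding ent_eq_expectation[OF S] expectation_funpow[OF S, of "\<lambda>l. - ln (law M (?I m) l)" m n, symmetric]
    by (intro Bochner_Integration.integral_add expectation_simple(2)[OF S, of "\<lambda>l. - ln (law M (?I n) l)"]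
      expectation_simple(2)[OF simple_funpow[OF S], of "\<lambda>l. - ln (law M (?I m) l)"])
  finally show ?thesis by simp
qed

lemma entropy_wrt_fibres_LIMSEQ:
  assumes X: "simple_function M X"
  shows "(\<lambda>n. ent M (itinerary X T n) / real n) \<longlonglongrightarrow> entropy_wrt M T (fibres M X)"
proof -
  have "convergent (\<lambda>n. ent M (itinerary X T n) / real n)"
    by (intro fekete ent_nonneg ent_itinerary_subadditive X)
  then show ?thesis
    by (simp add: entropy_wrt_def iterated_join_fibres funpow_space partition_entropy_fibres convergent_LIMSEQ_iff)
qed

lemma entropy_wrt_fibres_le:
  assumes X: "simple_function M X" and le: "\<And>n. ent M (itinerary X T n) \<le> real n * h + c"
  shows "entropy_wrt M T (fibres M X) \<le> h"
proof (rule LIMSEQ_le[OF entropy_wrt_fibres_LIMSEQ[OF X]])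
  have "(\<lambda>n. h + c / real n) \<longlonglongrightarrow> h + 0"
    by (intro tendsto_add tendsto_const lim_const_over_n)
  then show "(\<lambda>n. h + c / real n) \<longlonglongrightarrow> h" by simp
  have "ent M (itinerary X T n) / real n \<le> h + c / real n" if "n \<ge> 1" for n
  proof -
    have "ent M (itinerary X T n) / real n \<le> (real n * h + c) / real n"
      using le by (intro divide_right_mono) auto
    with that show ?thesis by (simp add: add_divide_distrib)
  qed
  then show "\<exists>N. \<forall>n\<ge>N. ent M (itinerary X T n) / real n \<le> h + c / real n" by blast
qed

end

section \<open>Approximation by functions of finitely many symbols\<close>

lemma shift_funpow: "(shift ^^ i) \<xi> = (\<lambda>j. \<xi> (i + j))"
  by (induction i) (auto simp: shift_def)

lemma shift_space_bound: "\<xi> \<in> shift_space \<Longrightarrow> \<xi> k < 4"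
  unfolding shift_space_def by (auto dest!: spec[of _ k])

text \<open>In contrast to \<open>locally_constant\<close>, the condition ranges over all sequences.
  It is applied to itineraries, whose entries beyond their length are \<open>undefined\<close> and
  which need not lie in \<open>shift_space\<close>.\<close>

definition depends_on :: "nat \<Rightarrow> ((nat \<Rightarrow> nat) \<Rightarrow> 'b) \<Rightarrow> bool" where
  "depends_on m g \<longleftrightarrow> (\<forall>\<xi> \<eta>. (\<forall>i<m. \<xi> i = \<eta> i) \<longrightarrow> g \<xi> = g \<eta>)"

lemma depends_onD: "depends_on m g \<Longrightarrow> (\<And>i. i < m \<Longrightarrow> \<xi> i = \<eta> i) \<Longrightarrow> g \<xi> = g \<eta>"
  by (simp add: depends_on_def)

lemma depends_on_mono: "depends_on m g \<Longrightarrow> m \<le> n \<Longrightarrow> depends_on n g"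
  unfolding depends_on_def by (meson less_le_trans)

lemma open_coordinate: "open ((\<lambda>\<xi> :: nat \<Rightarrow> nat. \<xi> i) -` D)"
  by (intro open_vimage continuous_on_product_coordinates discrete_topology_class.open_discrete)

lemma depends_on_continuous:
  fixes g :: "(nat \<Rightarrow> nat) \<Rightarrow> 'b :: topological_space"
  assumes "depends_on m g" shows "continuous_on A g"
proof -
  have "(g \<longlongrightarrow> g \<xi>) (at \<xi> within A)" for \<xi>
  proof -
    define U where "U = (\<Inter>i<m. (\<lambda>\<eta> :: nat \<Rightarrow> nat. \<eta> i) -` {\<xi> i})"
    have "open U" unfolding U_def by (intro open_INT ballI open_coordinate) simp
    moreover have "\<xi> \<in> U" by (simp add: U_def)
    moreover have "\<forall>\<eta>\<in>U. g \<eta> = g \<xi>"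
      unfolding U_def by (intro ballI depends_onD[OF assms]) simp
    ultimately have "eventually (\<lambda>\<eta>. g \<eta> = g \<xi>) (at \<xi> within A)"
      unfolding eventually_at_topological by blast
    then show ?thesis by (rule tendsto_eventually)
  qed
  then show ?thesis by (simp add: continuous_on_def)
qed

locale shift_invariant =
  fixes M :: "(nat \<Rightarrow> nat) measure"
  assumes invariant: "M \<in> invariant_measures"

sublocale shift_invariant \<subseteq> measure_preserving_system M shift
proof -
  interpret prob_space M using invariant by (simp add: invariant_measures_def)
  show "measure_preserving_system M shift"
    by standard (use invariant in \<open>simp_all add: invariant_measures_def\<close>)
qed

context shift_invariant begin

lemma sets_M: "sets M = sets (restrict_space borel shift_space)"
  using invariant by (simp add: invariant_measures_def)

lemma space_M: "space M = shift_space"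
  using sets_eq_imp_space_eq[OF sets_M] by (simp add: space_restrict_space)

lemma events_iff: "A \<in> events \<longleftrightarrow> (\<exists>B\<in>sets borel. A = B \<inter> shift_space)"
  unfolding sets_M sets_restrict_space by auto

abbreviation symbol :: "(nat \<Rightarrow> nat) \<Rightarrow> nat" where "symbol \<xi> \<equiv> \<xi> 0"

lemma simple_symbol: "simple_function M symbol"
  unfolding simple_function_def
proof (intro conjI ballI)
  show "finite (symbol ` space M)"
    by (rule finite_subset[of _ "{..<4}"]) (auto simp: space_M shift_space_bound)
  show "symbol -` {z} \<inter> space M \<in> events" for z
    unfolding events_iff space_M by (rule bexI[OF refl borel_open[OF open_coordinate]])
qed

lemma simple_depends_on:
  assumes "depends_on m g" shows "simple_function M g"
proof -
  have "g (itinerary symbol shift m \<xi>) = g \<xi>" for \<xi>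
    by (rule depends_onD[OF assms]) (simp add: shift_funpow)
  then show ?thesis
    using simple_function_compose1[OF simple_itinerary[OF simple_symbol], of g m] by simp
qed

lemma event_depends_on:
  assumes "depends_on m (\<lambda>\<xi>. \<xi> \<in> B)" shows "B \<inter> space M \<in> events"
  using simple_functionD(2)[OF simple_depends_on[OF assms], of "{True}"] by (simp add: vimage_def)

text \<open>The approximable sets contain the sets given by one coordinate and are closed under
  complements and countable unions. For a union, half of the error goes to cutting it down to
  finitely many members, the other half to approximating these.\<close>

lemma event_approximation:
  assumes "A \<in> events" "e > 0"
  obtains m B where "depends_on m (\<lambda>\<xi>. \<xi> \<in> B)" "measure M ((sym_diff A B) \<inter> space M) < e"
proof -
  define good where "good A \<longleftrightarrow> (\<forall>e>0. \<exists>m B. depends_on m (\<lambda>\<xi>. \<xi> \<in> B) \<and>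
    measure M (sym_diff A B \<inter> space M) < e)" for A :: "(nat \<Rightarrow> nat) set"
  have ev: "C \<inter> space M \<in> events" if "C \<in> sets borel" for C
    using that by (auto simp: events_iff space_M)
  have borel_eq: "sets (borel :: (nat \<Rightarrow> nat) measure) = sigma_sets UNIV {{\<xi>. \<xi> i \<in> D} | i D. True}"
    using sets_PiM_single[of UNIV "\<lambda>_::nat. borel :: nat measure"]
    by (simp add: sets_PiM_equal_borel borel_open[OF discrete_topology_class.open_discrete])
  have "C \<in> sets borel \<and> good C" if "C \<in> sigma_sets UNIV {{\<xi> :: nat \<Rightarrow> nat. \<xi> i \<in> D} | i D. True}" for C
    using that
  proof (induction rule: sigma_sets.induct)
    case (Basic C)
    then obtain i D where C: "C = {\<xi>. \<xi> i \<in> D}" by auto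
    then have "C \<in> sets borel" unfolding borel_eq by auto
    moreover have "depends_on (Suc i) (\<lambda>\<xi>. \<xi> \<in> C)" by (auto simp: depends_on_def C)
    then have "good C" unfolding good_def by (intro allI impI exI[of _ "Suc i"] exI[of _ C]) simp
    ultimately show ?case by simp
  next
    case Empty
    have "depends_on 0 (\<lambda>\<xi>. \<xi> \<in> ({} :: (nat \<Rightarrow> nat) set))" by (simp add: depends_on_def)
    then have "good {}" unfolding good_def by (intro allI impI exI[of _ 0] exI[of _ "{}"]) simp
    then show ?case by simp
  next
    case (Compl C)
    have "good (- C)" unfolding good_def
    proof (intro allI impI)
      fix e :: real assume "e > 0"
      then obtain m B where "depends_on m (\<lambda>\<xi>. \<xi> \<in> B)" "measure M (sym_diff C B \<inter> space M) < e"
        using Compl.IH unfolding good_def by blast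
      moreover have "sym_diff (- C) (- B) = sym_diff C B" by auto
      ultimately show "\<exists>m B. depends_on m (\<lambda>\<xi>. \<xi> \<in> B) \<and> measure M (sym_diff (- C) B \<inter> space M) < e"
        by (intro exI[of _ m] exI[of _ "- B"]) (auto simp: depends_on_def)
    qed
    then show ?case using Compl.IH by (auto simp: Compl_eq_Diff_UNIV[symmetric])
  next
    case (Union C)
    then have C: "C i \<in> sets borel" "good (C i)" for i by auto
    have "good (\<Union>i. C i)" unfolding good_def
    proof (intro allI impI)
      fix e :: real assume e: "e > 0"
      define D where "D n = (\<Union>i<n. C i \<inter> space M)" for n
      have D: "D n \<in> events" for n
        unfolding D_def by (rule sets.finite_UN) (simp_all only: ev[OF C(1)] finite_lessThan)
      then have UD: "(\<Union>n. D n) \<in> events" by blast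
      have "(\<lambda>n. prob (D n)) \<longlonglongrightarrow> prob (\<Union>n. D n)"
      proof (rule finite_Lim_measure_incseq)
        show "range D \<subseteq> events" using D by blast
        show "incseq D" unfolding D_def by (intro monoI UN_mono) auto
      qed
      then obtain n where n: "norm (prob (D n) - prob (\<Union>n. D n)) < e / 2"
        using e LIMSEQ_D[of _ _ "e/2"] by (meson half_gt_zero order_refl)
      \<comment> \<open>The summand 1 keeps the denominator positive when
        \<open>n = 0\<close>.\<close>
      have "\<exists>m B. depends_on m (\<lambda>\<xi>. \<xi> \<in> B) \<and> prob (sym_diff (C i) B \<inter> space M) < e / (2 * (real n + 1))" for i
        using C(2)[of i] e unfolding good_def by simp
      then obtain m B where mB: "\<And>i. depends_on (m i) (\<lambda>\<xi>. \<xi> \<in> B i)"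
        "\<And>i. prob (sym_diff (C i) (B i) \<inter> space M) < e / (2 * (real n + 1))" by metis
      define E where "E i = sym_diff (C i) (B i) \<inter> space M" for i
      have E: "E i \<in> events" for i
      proof -
        have "E i = sym_diff (C i \<inter> space M) (B i \<inter> space M)" by (auto simp: E_def)
        then show ?thesis using ev[OF C(1)] event_depends_on[OF mB(1)] by (metis sets.Diff sets.Un)
      qed
      then have UE: "(\<Union>i<n. E i) \<in> events" by blast
      have "depends_on (Max (insert 0 (m ` {..<n}))) (\<lambda>\<xi>. \<xi> \<in> (\<Union>i<n. B i))"
      proof -
        have "depends_on (Max (insert 0 (m ` {..<n}))) (\<lambda>\<xi>. \<xi> \<in> B i)" if "i < n" for i
          using that by (intro depends_on_mono[OF mB(1)] Max_ge) auto
        then show ?thesis unfolding depends_on_def by blast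
      qed
      moreover have "prob (sym_diff (\<Union>i. C i) (\<Union>i<n. B i) \<inter> space M) < e"
      proof -
        have "sym_diff (\<Union>i. C i) (\<Union>i<n. B i) \<inter> space M \<subseteq> ((\<Union>n. D n) - D n) \<union> (\<Union>i<n. E i)"
          unfolding D_def E_def by blast
        then have "prob (sym_diff (\<Union>i. C i) (\<Union>i<n. B i) \<inter> space M) \<le> prob (((\<Union>n. D n) - D n) \<union> (\<Union>i<n. E i))"
          by (rule finite_measure_mono[OF _ sets.Un[OF sets.Diff[OF UD D] UE]])
        also have "\<dots> \<le> prob ((\<Union>n. D n) - D n) + prob (\<Union>i<n. E i)"
          by (rule measure_Un_le[OF sets.Diff[OF UD D] UE])
        also have "prob ((\<Union>n. D n) - D n) = prob (\<Union>n. D n) - prob (D n)"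
          by (rule finite_measure_Diff[OF UD D]) blast
        also have "prob (\<Union>i<n. E i) \<le> (\<Sum>i<n. prob (E i))"
          by (rule measure_UNION_le) (use E in auto)
        also have "\<dots> \<le> (\<Sum>i<n. e / (2 * (real n + 1)))"
          unfolding E_def using mB(2) by (intro sum_mono less_imp_le)
        also have "\<dots> \<le> e / 2" using e by (simp add: field_simps)
        finally show ?thesis using n unfolding real_norm_def by linarith
      qed
      ultimately show "\<exists>m B. depends_on m (\<lambda>\<xi>. \<xi> \<in> B) \<and> measure M (sym_diff (\<Union>i. C i) B \<inter> space M) < e"
        by blast
    qed
    then show ?case using C(1) by auto
  qed
  moreover obtain C where C: "C \<in> sets borel" "A = C \<inter> space M"
    using assms(1) by (auto simp: events_iff space_M)
  ultimately have "good C" unfolding borel_eq by blast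
  then obtain m B where "depends_on m (\<lambda>\<xi>. \<xi> \<in> B)" "measure M (sym_diff C B \<inter> space M) < e"
    using assms(2) unfolding good_def by blast
  moreover have "sym_diff A B \<inter> space M = sym_diff C B \<inter> space M" using C by auto
  ultimately show thesis using that by metis
qed

lemma simple_approximation:
  assumes X: "simple_function M X" and e: "e > 0"
  obtains m g where "depends_on m g" "prob {\<xi>\<in>space M. X \<xi> \<noteq> g \<xi>} < e"
proof -
  let ?R = "X ` space M"
  have fin: "finite ?R" using X by (simp add: simple_function_def)
  define d where "d = e / (real (card ?R) + 1)"
  have d: "d > 0" using e by (simp add: d_def add_nonneg_pos)
  have evX: "X -` {a} \<inter> space M \<in> events" for a using X by (rule simple_functionD)
  have "\<exists>m B. depends_on m (\<lambda>\<xi>. \<xi> \<in> B) \<and> prob (sym_diff (X -` {a} \<inter> space M) B \<inter> space M) < d" for a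
    using event_approximation[OF evX d] by metis
  then obtain m B where mB: "\<And>a. depends_on (m a) (\<lambda>\<xi>. \<xi> \<in> B a)"
    "\<And>a. prob (sym_diff (X -` {a} \<inter> space M) (B a) \<inter> space M) < d" by metis
  define g where "g \<xi> = (THE a. a \<in> ?R \<and> \<xi> \<in> B a)" for \<xi>
  define E where "E a = sym_diff (X -` {a} \<inter> space M) (B a) \<inter> space M" for a
  have ev: "E a \<in> events" for a
  proof -
    have "E a = sym_diff (X -` {a} \<inter> space M) (B a \<inter> space M)" by (auto simp: E_def)
    then show ?thesis using evX event_depends_on[OF mB(1)] by (metis sets.Diff sets.Un)
  qed
  \<comment> \<open>On the exceptional set the description in \<open>g\<close> may fail to denote,
    but sequences that agree on these coordinates satisfy the same description, so \<open>g\<close>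
    agrees on them anyway.\<close>
  have "depends_on (Max (insert 0 (m ` ?R))) g"
  proof -
    have "depends_on (Max (insert 0 (m ` ?R))) (\<lambda>\<xi>. \<xi> \<in> B a)" if "a \<in> ?R" for a
      using that fin by (intro depends_on_mono[OF mB(1)] Max_ge) auto
    then have *: "(\<lambda>a. a \<in> ?R \<and> \<xi> \<in> B a) = (\<lambda>a. a \<in> ?R \<and> \<eta> \<in> B a)"
      if "\<forall>i<Max (insert 0 (m ` ?R)). \<xi> i = \<eta> i" for \<xi> \<eta>
      using that unfolding depends_on_def by (intro ext) blast
    show ?thesis unfolding depends_on_def g_def by (intro allI impI) (subst *, assumption, rule refl)
  qed
  moreover have "prob {\<xi>\<in>space M. X \<xi> \<noteq> g \<xi>} < e"
  proof -
    have "{\<xi>\<in>space M. X \<xi> \<noteq> g \<xi>} \<subseteq> (\<Union>a\<in>?R. E a)"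
    proof
      fix \<xi> assume "\<xi> \<in> {\<xi>\<in>space M. X \<xi> \<noteq> g \<xi>}"
      then have \<xi>: "\<xi> \<in> space M" "X \<xi> \<noteq> g \<xi>" by simp_all
      show "\<xi> \<in> (\<Union>a\<in>?R. E a)"
      proof (rule ccontr)
        assume "\<xi> \<notin> (\<Union>a\<in>?R. E a)"
        then have *: "\<xi> \<in> B a \<longleftrightarrow> X \<xi> = a" if "a \<in> ?R" for a
          using \<xi>(1) that unfolding E_def by blast
        have "X \<xi> \<in> ?R" using \<xi>(1) by (rule imageI)
        then have "X \<xi> \<in> ?R \<and> \<xi> \<in> B (X \<xi>)" by (simp only: *)
        moreover have "a = X \<xi>" if "a \<in> ?R \<and> \<xi> \<in> B a" for a
          using *[of a] that by simp
        ultimately have "g \<xi> = X \<xi>" unfolding g_def by (rule the_equality)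
        with \<xi>(2) show False by simp
      qed
    qed
    then have "prob {\<xi>\<in>space M. X \<xi> \<noteq> g \<xi>} \<le> prob (\<Union>a\<in>?R. E a)"
      by (rule finite_measure_mono) (use ev fin in blast)
    also have "\<dots> \<le> (\<Sum>a\<in>?R. prob (E a))"
      by (rule measure_UNION_le[OF fin ev])
    also have "\<dots> \<le> (\<Sum>a\<in>?R. d)" unfolding E_def using mB(2) by (intro sum_mono less_imp_le)
    also have "\<dots> = real (card ?R) * d" by simp
    also have "\<dots> < (real (card ?R) + 1) * d" using d by simp
    also have "\<dots> = e" unfolding d_def by (simp add: field_simps add_nonneg_eq_0_iff)
    finally show ?thesis .
  qed
  ultimately show thesis by (rule that)
qed

end

section \<open>Entropy is bounded by the entropy of the first symbol\<close>

context shift_invariant begin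

text \<open>Up to rare errors, the labels of \<open>X\<close> are functions of finitely many
  symbols. The pair of label name and symbol name is coded at a cost of about one symbol entropy per
  step, and Gibbs' inequality with \<open>fst\<close> then drops the symbols.\<close>

lemma entropy_wrt_fibres_le_symbol:
  fixes X :: "(nat \<Rightarrow> nat) \<Rightarrow> 'b"
  assumes X: "simple_function M X"
  shows "entropy_wrt M shift (fibres M X) \<le> ent M symbol"
proof (rule field_le_epsilon)
  fix e :: real assume e: "e > 0"
  define R where "R = X ` space M"
  define Y where "Y = symbol ` space M"
  define k where "k = real (card R)"
  have fin: "finite R" "finite Y" using X simple_symbol by (simp_all add: R_def Y_def simple_function_def)
  have "R \<noteq> {}" using not_empty by (simp add: R_def)
  then have k: "k \<ge> 1" using fin by (simp add: k_def Suc_le_eq card_gt_0_iff)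
  \<comment> \<open>A correct label costs \<open>- ln (1 - \<delta>) = e / 2\<close> and a wrong one
    \<open>L\<close>. The error frequency is made so small that wrong labels add at most another
    \<open>e / 2\<close> on average.\<close>
  define \<delta> where "\<delta> = 1 - exp (- e / 2)"
  have \<delta>: "0 < \<delta>" "\<delta> < 1" "- ln (1 - \<delta>) = e / 2" using e by (simp_all add: \<delta>_def)
  define L where "L = - ln (\<delta> / k)"
  have "\<delta> / k \<le> 1" "\<delta> / k > 0" using \<delta> k by simp_all
  then have L: "L \<ge> 0" by (simp add: L_def)
  have "e / 2 / (L + 1) > 0" using e L by simp
  then obtain m g where g: "depends_on m g" "prob {\<xi>\<in>space M. X \<xi> \<noteq> g \<xi>} < e / 2 / (L + 1)"
    using simple_approximation[OF X] by blast
  define \<kappa> where "\<kappa> a c = (if a = c then 1 - \<delta> else \<delta> / k)" for a c :: 'b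
  have \<kappa>_pos: "\<kappa> a c > 0" for a c using \<delta> k by (simp add: \<kappa>_def)
  have \<kappa>_sum: "(\<Sum>a\<in>R. \<kappa> a c) \<le> 1" for c
  proof -
    have "(\<Sum>a\<in>R. \<kappa> a c) \<le> (\<Sum>a\<in>R. (if a = c then 1 - \<delta> else 0) + \<delta> / k)"
      using \<delta> k by (intro sum_mono) (simp add: \<kappa>_def)
    also have "\<dots> = (\<Sum>a\<in>R. if a = c then 1 - \<delta> else 0) + \<delta>"
      using k by (simp add: sum.distrib k_def)
    also have "\<dots> \<le> 1" using fin \<delta> by (simp add: sum.delta)
    finally show ?thesis .
  qed
  let ?r = "law M symbol"
  have gS: "simple_function M g" using g(1) by (rule simple_depends_on)
  have XgS: "simple_function M (\<lambda>\<xi>. (X \<xi>, g \<xi>))" using X gS by (rule simple_function_Pair)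
  have mismatch: "expectation (\<lambda>\<xi>. - ln (\<kappa> (X \<xi>) (g \<xi>))) \<le> e"
  proof -
    let ?D = "{\<xi>\<in>space M. X \<xi> \<noteq> g \<xi>}"
    have D: "?D \<in> events"
      using simple_functionD(2)[OF simple_function_compose1[OF XgS, of "\<lambda>(a, c). a \<noteq> c"], of "{True}"]
      by (simp add: vimage_def Int_def conj_commute)
    have int: "integrable M (\<lambda>\<xi>. e / 2 + L * indicator ?D \<xi>)"
      using D by (intro Bochner_Integration.integrable_add integrable_mult_right integrable_real_indicator integrable_const)
        (auto simp: less_top[symmetric])
    have "expectation (\<lambda>\<xi>. - ln (\<kappa> (X \<xi>) (g \<xi>))) \<le> expectation (\<lambda>\<xi>. e / 2 + L * indicator ?D \<xi>)"
    proof (rule integral_mono[OF _ int])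
      show "integrable M (\<lambda>\<xi>. - ln (\<kappa> (X \<xi>) (g \<xi>)))"
        using expectation_simple(2)[OF XgS, of "\<lambda>(a, c). - ln (\<kappa> a c)"] by simp
      show "- ln (\<kappa> (X \<xi>) (g \<xi>)) \<le> e / 2 + L * indicator ?D \<xi>" if "\<xi> \<in> space M" for \<xi>
        using that \<delta>(3) e by (auto simp: \<kappa>_def L_def)
    qed
    also have "\<dots> = e / 2 + L * prob ?D"
      using D by (subst Bochner_Integration.integral_add)
        (auto simp: prob_space less_top[symmetric] intro!: integrable_mult_right integrable_real_indicator)
    also have "L * prob ?D \<le> L * (e / 2 / (L + 1))" using g(2) L by (intro mult_left_mono) auto
    also have "\<dots> \<le> e / 2" using L e by (simp add: field_simps)
    finally show ?thesis by simp
  qed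
  show "entropy_wrt M shift (fibres M X) \<le> ent M symbol + e"
  proof (rule entropy_wrt_fibres_le[OF X])
    fix n
    \<comment> \<open>The approximate label at \<open>i < n\<close> reads the symbols at
      \<open>i + j\<close> with \<open>j < m\<close>, all below \<open>N\<close>. The
      \<open>m\<close> extra symbols cost an amount independent of \<open>n\<close>, which vanishes
      in the rate.\<close>
    define N where "N = n + m"
    define W where "W \<xi> = (itinerary X shift n \<xi>, itinerary symbol shift N \<xi>)" for \<xi>
    \<comment> \<open>The code for the name of length \<open>n\<close>: list \<open>N\<close> symbols independently with their frequencies, read off the
      approximate labels \<open>g\<close>, and correct each of them with the noise kernel \<open>\<kappa>\<close>.\<close>
    define q where "q w = (\<Prod>i<N. ?r (snd w i)) * (\<Prod>i<n. \<kappa> (fst w i) (g (\<lambda>j. snd w (i + j))))"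
      for w :: "(nat \<Rightarrow> 'b) \<times> (nat \<Rightarrow> nat)"
    have W: "simple_function M W"
      unfolding W_def by (intro simple_function_Pair simple_itinerary X simple_symbol)
    have gW: "g (\<lambda>j. snd (W \<xi>) (i + j)) = g ((shift ^^ i) \<xi>)" if "i < n" for i \<xi>
      using that by (intro depends_onD[OF g(1)]) (simp add: W_def N_def shift_funpow)
    have qW: "q (W \<xi>) = (\<Prod>i<N. ?r (symbol ((shift ^^ i) \<xi>))) * (\<Prod>i<n. \<kappa> (X ((shift ^^ i) \<xi>)) (g ((shift ^^ i) \<xi>)))" for \<xi>
      unfolding q_def by (intro arg_cong2[where f="(*)"] prod.cong) (simp_all add: gW, simp_all add: W_def)
    have AE_r: "AE \<xi> in M. \<forall>i\<in>{..<N}. ?r (symbol ((shift ^^ i) \<xi>)) > 0"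
    proof (rule AE_finite_allI)
      show "AE \<xi> in M. ?r (symbol ((shift ^^ i) \<xi>)) > 0" for i
        using AE_law_pos[OF simple_funpow[OF simple_symbol, of i]] by (simp add: law_funpow[OF simple_symbol])
    qed simp
    have "ent M (\<lambda>\<xi>. fst (W \<xi>)) \<le> expectation (\<lambda>\<xi>. - ln (q (W \<xi>)))"
    proof (rule ent_le_cross_entropy[OF W])
      show q_nonneg: "q w \<ge> 0" for w
        unfolding q_def by (intro mult_nonneg_nonneg prod_nonneg) (auto intro: less_imp_le[OF \<kappa>_pos])
      let ?A = "{..<n} \<rightarrow>\<^sub>E R" and ?B = "{..<N} \<rightarrow>\<^sub>E Y"
      have finAB: "finite ?A" "finite ?B" using fin by (auto intro: finite_PiE)
      have "W ` space M \<subseteq> ?A \<times> ?B"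
        using funpow_space by (auto simp: W_def itinerary_def R_def Y_def PiE_def extensional_def)
      then have "(\<Sum>w\<in>W ` space M. q w) \<le> (\<Sum>w\<in>?A \<times> ?B. q w)"
        using finAB q_nonneg by (intro sum_mono2) auto
      also have "\<dots> = (\<Sum>l\<in>?A. \<Sum>y\<in>?B. q (l, y))"
        by (simp add: sum.cartesian_product)
      \<comment> \<open>The labels are summed out first: for a fixed symbol word the kernel factors
        separate, and each sums to at most 1.\<close>
      also have "\<dots> = (\<Sum>y\<in>?B. \<Sum>l\<in>?A. q (l, y))" by (rule sum.swap)
      also have "\<dots> = (\<Sum>y\<in>?B. (\<Prod>i<N. ?r (y i)) * (\<Sum>l\<in>?A. \<Prod>i<n. \<kappa> (l i) (g (\<lambda>j. y (i + j)))))"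
        by (simp add: q_def sum_distrib_left)
      also have "\<dots> = (\<Sum>y\<in>?B. (\<Prod>i<N. ?r (y i)) * (\<Prod>i<n. \<Sum>a\<in>R. \<kappa> a (g (\<lambda>j. y (i + j)))))"
        using fin by (subst prod_sum_PiE) auto
      also have "\<dots> \<le> (\<Sum>y\<in>?B. (\<Prod>i<N. ?r (y i)) * 1)"
        using \<kappa>_sum by (intro sum_mono mult_left_mono prod_le_1 prod_nonneg conjI sum_nonneg) (auto intro: less_imp_le[OF \<kappa>_pos])
      also have "\<dots> = (\<Prod>i<N. \<Sum>a\<in>Y. ?r a)" using fin by (subst prod_sum_PiE) auto
      also have "\<dots> = 1" using sum_law[OF simple_symbol] by (simp add: Y_def)
      finally show "(\<Sum>w\<in>W ` space M. q w) \<le> 1" .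
      show "AE \<xi> in M. q (W \<xi>) > 0"
        using AE_r by eventually_elim (auto simp: qW intro!: mult_pos_pos prod_pos \<kappa>_pos)
    qed
    also have "\<dots> = expectation (\<lambda>\<xi>. (\<Sum>i<N. - ln (?r (symbol ((shift ^^ i) \<xi>)))) +
        (\<Sum>i<n. - ln (\<kappa> (X ((shift ^^ i) \<xi>)) (g ((shift ^^ i) \<xi>)))))" (is "_ = expectation ?f")
    proof (rule integral_cong_AE)
      show "(\<lambda>\<xi>. - ln (q (W \<xi>))) \<in> borel_measurable M"
        using expectation_simple(2)[OF W, of "\<lambda>w. - ln (q w)"] by blast
      show "?f \<in> borel_measurable M"
        using expectation_simple(2)[OF simple_funpow[OF simple_symbol], of "\<lambda>a. - ln (?r a)"]
          expectation_simple(2)[OF simple_funpow[OF XgS], of "\<lambda>(a, c). - ln (\<kappa> a c)"]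
        by (intro borel_measurable_add borel_measurable_sum) auto
      show "AE \<xi> in M. - ln (q (W \<xi>)) = ?f \<xi>"
        using AE_r
      proof eventually_elim
        case (elim \<xi>)
        have "ln (\<Prod>i<N. ?r (symbol ((shift ^^ i) \<xi>))) = (\<Sum>i<N. ln (?r (symbol ((shift ^^ i) \<xi>))))"
          using elim by (intro ln_prod) (simp, metis less_irrefl)
        moreover have "ln (\<Prod>i<n. \<kappa> (X ((shift ^^ i) \<xi>)) (g ((shift ^^ i) \<xi>))) =
            (\<Sum>i<n. ln (\<kappa> (X ((shift ^^ i) \<xi>)) (g ((shift ^^ i) \<xi>))))"
          by (intro ln_prod) (simp, metis \<kappa>_pos less_irrefl)
        moreover have "(\<Prod>i<N. ?r (symbol ((shift ^^ i) \<xi>))) > 0"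
          "(\<Prod>i<n. \<kappa> (X ((shift ^^ i) \<xi>)) (g ((shift ^^ i) \<xi>))) > 0"
          using elim by (auto intro!: prod_pos \<kappa>_pos)
        ultimately show ?case unfolding qW by (simp add: ln_mult_pos sum_negf)
      qed
    qed
    also have "\<dots> = (\<Sum>i<N. expectation (\<lambda>\<xi>. - ln (?r (symbol ((shift ^^ i) \<xi>))))) +
        (\<Sum>i<n. expectation (\<lambda>\<xi>. - ln (\<kappa> (X ((shift ^^ i) \<xi>)) (g ((shift ^^ i) \<xi>)))))"
    proof -
      have i1: "integrable M (\<lambda>\<xi>. - ln (?r (symbol ((shift ^^ i) \<xi>))))" for i
        by (rule expectation_simple(2)[OF simple_funpow[OF simple_symbol], of "\<lambda>a. - ln (?r a)"])
      have i2: "integrable M (\<lambda>\<xi>. - ln (\<kappa> (X ((shift ^^ i) \<xi>)) (g ((shift ^^ i) \<xi>))))" for i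
        using expectation_simple(2)[OF simple_funpow[OF XgS], of "\<lambda>(a, c). - ln (\<kappa> a c)" i] by simp
      show ?thesis
        using Bochner_Integration.integral_add[OF Bochner_Integration.integrable_sum[of "{..<N}", OF i1]
            Bochner_Integration.integrable_sum[of "{..<n}", OF i2]]
        unfolding Bochner_Integration.integral_sum[of "{..<N}", OF i1] Bochner_Integration.integral_sum[of "{..<n}", OF i2] .
    qed
    also have "\<dots> = (\<Sum>i<N. ent M symbol) + (\<Sum>i<n. expectation (\<lambda>\<xi>. - ln (\<kappa> (X \<xi>) (g \<xi>))))"
      using expectation_funpow[OF simple_symbol, of "\<lambda>a. - ln (?r a)"]
        expectation_funpow[OF XgS, of "\<lambda>(a, c). - ln (\<kappa> a c)"]
      by (simp add: ent_eq_expectation[OF simple_symbol])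
    also have "\<dots> = real N * ent M symbol + real n * expectation (\<lambda>\<xi>. - ln (\<kappa> (X \<xi>) (g \<xi>)))"
      by (simp only: sum_constant card_lessThan)
    also have "\<dots> \<le> real N * ent M symbol + real n * e"
      by (intro add_left_mono mult_left_mono mismatch) simp
    finally have "ent M (\<lambda>\<xi>. fst (W \<xi>)) \<le> real N * ent M symbol + real n * e" .
    then show "ent M (itinerary X shift n) \<le> real n * (ent M symbol + e) + real m * ent M symbol"
      by (simp add: W_def N_def algebra_simps)
  qed
qed

lemma ks_entropy_le_symbol: "ks_entropy M shift \<le> ereal (ent M symbol)"
  unfolding ks_entropy_def
proof (rule SUP_least)
  fix P assume "P \<in> {P. finite_measurable_partition M P}"
  then obtain X :: "(nat \<Rightarrow> nat) \<Rightarrow> (nat \<Rightarrow> nat) set" where "simple_function M X" "fibres M X = P"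
    using partition_eq_fibres by auto
  then show "ereal (entropy_wrt M shift P) \<le> ereal (ent M symbol)"
    using entropy_wrt_fibres_le_symbol by auto
qed

lemma entropy_wrt_fibres_le_ks_entropy:
  "simple_function M X \<Longrightarrow> ereal (entropy_wrt M shift (fibres M X)) \<le> ks_entropy M shift"
  unfolding ks_entropy_def by (intro SUP_upper) (simp add: finite_measurable_partition_fibres)

lemma ks_entropy_nonneg: "ks_entropy M shift \<ge> 0"
proof -
  have "entropy_wrt M shift (fibres M symbol) \<ge> 0"
    by (rule LIMSEQ_le_const[OF entropy_wrt_fibres_LIMSEQ[OF simple_symbol]]) (simp add: ent_nonneg)
  then show ?thesis
    using entropy_wrt_fibres_le_ks_entropy[OF simple_symbol] by (metis ereal_less_eq(5) order_trans)
qed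

lemma ent_symbol: "ent M symbol = - (\<Sum>a<4. law M symbol a * ln (law M symbol a))"
  unfolding ent_def
proof (intro arg_cong[where f=uminus] sum.mono_neutral_left)
  show "symbol ` space M \<subseteq> {..<4}" by (auto simp: space_M shift_space_bound)
  have "law M symbol a = 0" if "a \<notin> symbol ` space M" for a
  proof -
    have "symbol -` {a} \<inter> space M = {}" using that by auto
    then show ?thesis by (simp add: law_def)
  qed
  then show "\<forall>a\<in>{..<4} - symbol ` space M. law M symbol a * ln (law M symbol a) = 0" by simp
qed simp

lemma sum_law_symbol: "(\<Sum>a<4. law M symbol a) = 1"
proof -
  have "(\<Sum>a<4. law M symbol a) = (\<Sum>a\<in>symbol ` space M. law M symbol a)"
  proof (intro sum.mono_neutral_right)
    show "symbol ` space M \<subseteq> {..<4}" by (auto simp: space_M shift_space_bound)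
    show "\<forall>a\<in>{..<4} - symbol ` space M. law M symbol a = 0"
    proof
      fix a assume "a \<in> {..<4} - symbol ` space M"
      then have "symbol -` {a} \<inter> space M = {}" by auto
      then show "law M symbol a = 0" by (simp add: law_def)
    qed
  qed simp
  then show ?thesis using sum_law[OF simple_symbol] by simp
qed

end

text \<open>The masses of rare symbols are known only through upper bounds, and
  \<open>- p ln p\<close> is not monotone; its majorant \<open>2 * sqrt p\<close> is. It comes from
  \<open>ln x \<le> x - 1\<close> at \<open>1 / sqrt p\<close>.\<close>

lemma entropy_term_le_sqrt:
  assumes "p \<ge> 0" shows "- (p * ln p) \<le> 2 * sqrt p"
proof (cases "p = 0")
  case False
  then have p: "p > 0" using assms by simp
  have "- ln p = 2 * ln (1 / sqrt p)" using p by (simp add: ln_div ln_sqrt)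
  also have "\<dots> \<le> 2 * (1 / sqrt p)" using p ln_le_minus_one[of "1 / sqrt p"] by simp
  finally have "p * (- ln p) \<le> p * (2 * (1 / sqrt p))" using p by (intro mult_left_mono) auto
  also have "\<dots> = 2 * (p / sqrt p)" by simp
  also have "p / sqrt p = sqrt p" using p by (intro real_div_sqrt) simp
  finally show ?thesis by simp
qed simp

text \<open>The tangent line of the concave function \<open>- p ln p\<close> at \<open>c\<close>.\<close>

lemma entropy_term_le_tangent:
  fixes p c :: real
  assumes "p \<ge> 0" "c > 0" shows "- (p * ln p) \<le> - (p * ln c) + c - p"
proof (cases "p = 0")
  case False
  then have p: "p > 0" using assms(1) by simp
  have "ln (c / p) \<le> c / p - 1" using p assms by (intro ln_le_minus_one) simp
  then have "p * ln (c / p) \<le> p * (c / p - 1)" using p by (intro mult_left_mono) auto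
  then show ?thesis using p assms by (simp add: ln_div algebra_simps)
qed (use assms in simp)

context shift_invariant begin

text \<open>The tangents at 1/2 bound the terms of the symbols 2 and 3 by \<open>ln 2\<close> plus
  the mass missing from these two symbols, which is at most \<open>q\<close>. The symbols 0 and 1
  contribute at most \<open>2 * sqrt q\<close> each.\<close>

lemma ks_entropy_le_ln2:
  assumes "prob {\<xi>\<in>space M. \<xi> 0 \<le> 1} \<le> q"
  shows "ks_entropy M shift \<le> ereal (ln 2 + q + 4 * sqrt q)"
proof -
  define p where "p = law M symbol"
  have p0: "p a \<ge> 0" for a by (simp add: p_def)
  have le: "p a \<le> q" if "a \<le> 1" for a
  proof -
    have "{\<xi>\<in>space M. \<xi> 0 \<le> 1} = symbol -` {..1} \<inter> space M" by auto
    also have "\<dots> \<in> events" using simple_functionD(2)[OF simple_symbol] .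
    finally have "p a \<le> prob {\<xi>\<in>space M. \<xi> 0 \<le> 1}"
      unfolding p_def law_def using that by (intro finite_measure_mono) auto
    with assms show ?thesis by simp
  qed
  have pq: "p 0 + p 1 \<le> q"
  proof -
    have m: "symbol -` A \<inter> space M \<in> events" for A using simple_functionD(2)[OF simple_symbol] .
    have "p 0 + p 1 = prob ((symbol -` {0} \<inter> space M) \<union> (symbol -` {1} \<inter> space M))"
      unfolding p_def law_def by (rule finite_measure_Union[OF m m, symmetric]) auto
    also have "(symbol -` {0} \<inter> space M) \<union> (symbol -` {1} \<inter> space M) = {\<xi>\<in>space M. \<xi> 0 \<le> 1}" by auto
    finally show ?thesis using assms by simp
  qed
  have sq: "- (p a * ln (p a)) \<le> 2 * sqrt q" if "a \<le> 1" for a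
    using entropy_term_le_sqrt[OF p0, of a] real_sqrt_le_mono[OF le[OF that]] by linarith
  have tg: "- (p a * ln (p a)) \<le> p a * ln 2 + 1 / 2 - p a" for a
    using entropy_term_le_tangent[OF p0, of "1/2" a] by (simp add: ln_div)
  have sum1: "p 0 + p 1 + p 2 + p 3 = 1"
    using sum_law_symbol by (simp add: p_def eval_nat_numeral)
  have "(p 2 + p 3) * ln 2 \<le> 1 * ln 2" using sum1 p0[of 0] p0[of 1] by (intro mult_right_mono) auto
  then have *: "p 2 * ln 2 + p 3 * ln 2 \<le> ln 2" by (simp add: distrib_right)
  have "ent M symbol = - (p 0 * ln (p 0)) - p 1 * ln (p 1) - p 2 * ln (p 2) - p 3 * ln (p 3)"
    by (simp add: ent_symbol p_def eval_nat_numeral)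
  also have "\<dots> \<le> ln 2 + q + 4 * sqrt q"
    using sq[of 0] sq[of 1] tg[of 2] tg[of 3] * sum1 pq by simp
  finally show ?thesis using ks_entropy_le_symbol by (meson ereal_less_eq(3) order_trans)
qed

text \<open>Only the symbol 2 is frequent: the tangent at 1 bounds its term by
  \<open>1 - p 2\<close>, which is the mass of the symbol 1.\<close>

lemma ks_entropy_le_single:
  assumes "law M symbol 0 = 0" "law M symbol 3 = 0" "law M symbol 1 \<le> q"
  shows "ks_entropy M shift \<le> ereal (q + 2 * sqrt q)"
proof -
  define p where "p = law M symbol"
  have p0: "p a \<ge> 0" for a by (simp add: p_def)
  have sum1: "p 0 + p 1 + p 2 + p 3 = 1"
    using sum_law_symbol by (simp add: p_def eval_nat_numeral)
  have "ent M symbol = - (p 0 * ln (p 0)) - p 1 * ln (p 1) - p 2 * ln (p 2) - p 3 * ln (p 3)"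
    by (simp add: ent_symbol p_def eval_nat_numeral)
  moreover have "- (p 1 * ln (p 1)) \<le> 2 * sqrt q"
    using entropy_term_le_sqrt[OF p0, of 1] real_sqrt_le_mono[OF assms(3)] unfolding p_def by linarith
  moreover have "- (p 2 * ln (p 2)) \<le> 1 - p 2"
    using entropy_term_le_tangent[OF p0, of 1 2] by simp
  ultimately have "ent M symbol \<le> q + 2 * sqrt q" using assms sum1 by (simp add: p_def)
  then show ?thesis using ks_entropy_le_symbol by (meson ereal_less_eq(3) order_trans)
qed

end

section \<open>The potential\<close>

text \<open>
  The sequence starts with \<open>2^j 1 2^m c\<close>, where \<open>c \<noteq> 2\<close>. For \<open>j \<le> m\<close> these cylinders cover the
  orbit of the periodic sequence \<open>1 2^m 1 2^m ...\<close>. Sequences starting with \<open>0\<close> are put into level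
  \<open>0\<close>, so that the symbol \<open>0\<close> is penalised as well.
\<close>

definition block :: "nat \<Rightarrow> nat \<Rightarrow> (nat \<Rightarrow> nat) \<Rightarrow> bool" where
  "block m j \<xi> \<longleftrightarrow> (\<forall>i<j. \<xi> i = 2) \<and> \<xi> j = 1 \<and> (\<forall>i. j < i \<and> i \<le> j + m \<longrightarrow> \<xi> i = 2) \<and> \<xi> (j + m + 1) \<noteq> 2"

definition level :: "nat \<Rightarrow> (nat \<Rightarrow> nat) set" where
  "level m = {\<xi>. \<xi> 0 = 0 \<and> m = 0 \<or> (\<exists>j\<le>m. block m j \<xi>)}"

text \<open>\<open>j\<close> is the first position with a symbol other than 2, and \<open>m\<close>
  is the length of the run of 2 after it, so the sequence determines both.\<close>

lemma block_unique: assumes "block m j \<xi>" "block n k \<xi>" shows "m = n"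
proof -
  note b = assms[unfolded block_def]
  have "\<not> j < k"
  proof
    assume "j < k"
    then have "\<xi> j = 2" using b(2) by simp
    with b(1) show False by simp
  qed
  moreover have "\<not> k < j"
  proof
    assume "k < j"
    then have "\<xi> k = 2" using b(1) by simp
    with b(2) show False by simp
  qed
  ultimately have jk: "j = k" by simp
  have "\<not> m < n"
  proof
    assume "m < n"
    then have "\<xi> (j + m + 1) = 2" using b(2) jk by simp
    with b(1) show False by simp
  qed
  moreover have "\<not> n < m"
  proof
    assume "n < m"
    then have "\<xi> (k + n + 1) = 2" using b(1) jk by simp
    with b(2) show False by simp
  qed
  ultimately show ?thesis by simp
qed

lemma block_zero: "block m j \<xi> \<Longrightarrow> \<xi> 0 \<noteq> 0"
  by (cases j) (simp_all add: block_def)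

lemma level_unique: assumes "\<xi> \<in> level m" "\<xi> \<in> level n" shows "m = n"
  using assms block_unique block_zero unfolding level_def mem_Collect_eq by metis

text \<open>The last coordinate read is \<open>j + m + 1\<close>, which is at most
  \<open>2 * m + 1\<close> because \<open>j \<le> m\<close>.\<close>

lemma level_depends_on: "depends_on (2 * m + 2) (\<lambda>\<xi>. \<xi> \<in> level m)"
  unfolding depends_on_def
proof (intro allI impI)
  fix \<xi> \<eta> :: "nat \<Rightarrow> nat" assume eq: "\<forall>i<2 * m + 2. \<xi> i = \<eta> i"
  have "block m j \<xi> \<longleftrightarrow> block m j \<eta>" if "j \<le> m" for j
  proof -
    have "(\<forall>i<j. \<xi> i = 2) \<longleftrightarrow> (\<forall>i<j. \<eta> i = 2)"
      "(\<forall>i. j < i \<and> i \<le> j + m \<longrightarrow> \<xi> i = 2) \<longleftrightarrow> (\<forall>i. j < i \<and> i \<le> j + m \<longrightarrow> \<eta> i = 2)"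
      by (intro all_cong imp_cong refl; use eq that in simp)+
    moreover have "\<xi> j = \<eta> j" "\<xi> (j + m + 1) = \<eta> (j + m + 1)" using eq that by simp_all
    ultimately show ?thesis by (simp add: block_def)
  qed
  moreover have "\<xi> 0 = \<eta> 0" using eq by simp
  ultimately show "(\<xi> \<in> level m) = (\<eta> \<in> level m)" unfolding level_def by auto
qed

text \<open>\<open>S\<close> is the set of retained levels: \<open>UNIV\<close> gives the full
  potential and \<open>{..n}\<close> its truncation, so that both are treated at once.\<close>

definition pot :: "nat set \<Rightarrow> (nat \<Rightarrow> nat) \<Rightarrow> real" where
  "pot S \<xi> = (if \<exists>m\<in>S. \<xi> \<in> level m then node (THE m. m \<in> S \<and> \<xi> \<in> level m) else 0)"

lemma pot_level: "\<xi> \<in> level m \<Longrightarrow> pot S \<xi> = (if m \<in> S then node m else 0)"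
proof -
  assume m: "\<xi> \<in> level m"
  then have *: "\<xi> \<in> level k \<longleftrightarrow> k = m" for k using level_unique by blast
  have "(THE k. k \<in> S \<and> k = m) = m" if "m \<in> S" using that by blast
  then show ?thesis by (simp add: pot_def *)
qed

lemma pot_outside: "(\<And>m. \<xi> \<notin> level m) \<Longrightarrow> pot S \<xi> = 0"
  by (simp add: pot_def)

lemma pot_in_nodes: "pot S \<xi> \<in> nodes"
  by (simp add: pot_def)

lemma abs_pot_le: "\<bar>pot S \<xi>\<bar> \<le> 1"
  using nodes_bounds[OF pot_in_nodes, of S \<xi>] by auto

lemma pot_truncate: "pot (S \<inter> {..n}) \<xi> = pot S \<xi> \<or> pot (S \<inter> {..n}) \<xi> = 0 \<and> \<bar>pot S \<xi>\<bar> \<le> (1/2) ^ (n + 1)"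
proof (cases "\<exists>m. \<xi> \<in> level m")
  case True
  then obtain m where m: "\<xi> \<in> level m" by blast
  have "(1/2) ^ m \<le> (1/2::real) ^ (n + 1)" if "\<not> m \<le> n" using that by (intro power_decreasing) auto
  then show ?thesis unfolding pot_level[OF m] by (auto simp: abs_node)
next
  case False
  then have "pot S' \<xi> = 0" for S' by (intro pot_outside) blast
  then show ?thesis by simp
qed

lemma pot_depends_on: "depends_on (2 * n + 2) (pot (S \<inter> {..n}))"
proof -
  have "\<xi> \<in> level m \<longleftrightarrow> \<eta> \<in> level m" if "\<forall>i<2 * n + 2. \<xi> i = \<eta> i" "m \<le> n" for \<xi> \<eta> m
    using that by (intro depends_onD[OF level_depends_on]) auto
  then have *: "(\<lambda>m. m \<in> S \<inter> {..n} \<and> \<xi> \<in> level m) = (\<lambda>m. m \<in> S \<inter> {..n} \<and> \<eta> \<in> level m)"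
    if "\<forall>i<2 * n + 2. \<xi> i = \<eta> i" for \<xi> \<eta> using that by (intro ext) auto
  define F where "F P = (if Ex P then node (The P) else 0)" for P
  have F: "pot T \<xi> = F (\<lambda>m. m \<in> T \<and> \<xi> \<in> level m)" for T \<xi>
    by (simp add: pot_def F_def Bex_def)
  show ?thesis unfolding depends_on_def F by (intro allI impI arg_cong[where f=F] *) simp
qed

lemma pot_continuous: "continuous_on A (pot S)"
proof (rule uniform_limit_theorem[OF _ _ sequentially_bot])
  show "\<forall>\<^sub>F n in sequentially. continuous_on A (pot (S \<inter> {..n}))"
    by (intro always_eventually allI depends_on_continuous[OF pot_depends_on])
  show "uniform_limit A (\<lambda>n. pot (S \<inter> {..n})) (pot S) sequentially"
  proof (rule uniform_limitI)
    fix e :: real assume "e > 0"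
    have "(\<lambda>n. (1/2::real) ^ n) \<longlonglongrightarrow> 0" by (rule LIMSEQ_power_zero) simp
    then have "\<forall>\<^sub>F n in sequentially. (1/2::real) ^ n < e"
      using \<open>e > 0\<close> by (rule order_tendstoD)
    then show "\<forall>\<^sub>F n in sequentially. \<forall>\<xi>\<in>A. dist (pot (S \<inter> {..n}) \<xi>) (pot S \<xi>) < e"
    proof eventually_elim
      case (elim n)
      have "(1/2) ^ (n + 1) \<le> (1/2::real) ^ n" by simp
      then have "\<bar>pot (S \<inter> {..n}) \<xi> - pot S \<xi>\<bar> \<le> (1/2) ^ n" for \<xi>
        using pot_truncate[of S n \<xi>] by fastforce
      then show ?case using elim by (auto simp: dist_real_def intro: le_less_trans)
    qed
  qed
qed

definition Phi :: "nat set \<Rightarrow> (nat \<Rightarrow> nat) \<Rightarrow> real^2" where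
  "Phi S \<xi> = parab (pot S \<xi>)"

lemma parab_eq: "parab t = t *\<^sub>R vector [1, 0] + t\<^sup>2 *\<^sub>R vector [0, 1]"
  by (simp add: vec_eq_iff forall_2)

lemma Phi_continuous: "continuous_on A (Phi S)"
  unfolding Phi_def parab_eq by (intro continuous_intros pot_continuous)

lemma norm_parab_le: assumes "\<bar>t\<bar> \<le> 1" shows "norm (parab t) \<le> 2 * \<bar>t\<bar>"
proof -
  have "norm (parab t) \<le> \<bar>t\<bar> + \<bar>t\<^sup>2\<bar>"
    using norm_le_l1_cart[of "parab t"] by (simp add: sum_2)
  also have "\<bar>t\<^sup>2\<bar> = \<bar>t\<bar> * \<bar>t\<bar>" by (simp add: power2_eq_square abs_mult)
  also have "\<dots> \<le> \<bar>t\<bar> * 1" using assms by (intro mult_left_mono) auto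
  finally show ?thesis by simp
qed

lemma norm_Phi_truncate: "norm (Phi UNIV \<xi> - Phi {..n} \<xi>) \<le> (1/2) ^ n"
  using pot_truncate[of UNIV n \<xi>]
proof
  assume "pot (UNIV \<inter> {..n}) \<xi> = pot UNIV \<xi>"
  then show ?thesis by (simp add: Phi_def)
next
  assume *: "pot (UNIV \<inter> {..n}) \<xi> = 0 \<and> \<bar>pot UNIV \<xi>\<bar> \<le> (1/2) ^ (n + 1)"
  then have "norm (Phi UNIV \<xi> - Phi {..n} \<xi>) = norm (parab (pot UNIV \<xi>))" by (simp add: Phi_def)
  also have "\<dots> \<le> 2 * \<bar>pot UNIV \<xi>\<bar>" by (rule norm_parab_le[OF abs_pot_le])
  finally show ?thesis using * by simp
qed

lemma sup_norm_Phi_truncate: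
  "0 \<le> sup_norm (\<lambda>\<xi>. Phi UNIV \<xi> - Phi {..n} \<xi>)" "sup_norm (\<lambda>\<xi>. Phi UNIV \<xi> - Phi {..n} \<xi>) \<le> (1/2) ^ n"
proof -
  have ne: "(\<lambda>_. 0) \<in> shift_space" by (simp add: shift_space_def)
  show "sup_norm (\<lambda>\<xi>. Phi UNIV \<xi> - Phi {..n} \<xi>) \<le> (1/2) ^ n"
    unfolding sup_norm_def using ne norm_Phi_truncate by (intro cSUP_least) auto
  show "0 \<le> sup_norm (\<lambda>\<xi>. Phi UNIV \<xi> - Phi {..n} \<xi>)"
    unfolding sup_norm_def using ne norm_Phi_truncate
    by (intro cSUP_upper2[of _ _ "\<lambda>_. 0"] bdd_aboveI2) auto
qed

lemma Phi_locally_constant: "locally_constant (Phi {..n})"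
  unfolding locally_constant_def Phi_def
  using depends_onD[OF pot_depends_on[of n UNIV]] by (intro exI[of _ "2 * n + 2"]) (metis inf_top_left)

text \<open>These are the sequences whose initial 1 escapes the small levels: if they have a level
  at all, it is at least \<open>k\<close>.\<close>

definition run :: "nat \<Rightarrow> (nat \<Rightarrow> nat) set" where
  "run k = {\<xi>. \<xi> 0 = 1 \<and> (\<forall>i. 1 \<le> i \<and> i \<le> k \<longrightarrow> \<xi> i = 2)}"

lemma low_symbol_cases:
  assumes "\<xi> 0 \<le> 1" "\<xi> \<notin> run (k + 1)"
  obtains m where "m \<le> k" "\<xi> \<in> level m"
proof (cases "\<xi> 0 = 0")
  case True
  then show thesis by (intro that[of 0]) (auto simp: level_def)
next
  case False
  with assms have 1: "\<xi> 0 = 1" by simp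
  with assms(2) have ex: "\<exists>i. 1 \<le> i \<and> i \<le> k + 1 \<and> \<xi> i \<noteq> 2" by (auto simp: run_def)
  define i where "i = (LEAST i. 1 \<le> i \<and> i \<le> k + 1 \<and> \<xi> i \<noteq> 2)"
  have i: "1 \<le> i" "i \<le> k + 1" "\<xi> i \<noteq> 2" using LeastI_ex[OF ex] by (simp_all add: i_def)
  have before: "\<xi> l = 2" if "1 \<le> l" "l < i" for l
    using not_less_Least[of l "\<lambda>i. 1 \<le> i \<and> i \<le> k + 1 \<and> \<xi> i \<noteq> 2", folded i_def] that i(2) by auto
  have "\<xi> \<in> level (i - 1)"
    unfolding level_def block_def using 1 i before by (intro CollectI disjI2 exI[of _ 0]) auto
  then show thesis using i by (intro that[of "i - 1"]) auto
qed

context shift_invariant begin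

lemma continuous_measurable: "continuous_on shift_space g \<Longrightarrow> g \<in> borel_measurable M"
  using borel_measurable_continuous_on_restrict[of shift_space g] measurable_cong_sets[OF sets_M refl] by blast

lemma pot_measurable: "pot S \<in> borel_measurable M"
  by (intro continuous_measurable pot_continuous)

lemma integrable_pot: "integrable M (pot S)" "integrable M (\<lambda>\<xi>. (pot S \<xi>)\<^sup>2)"
proof -
  show "integrable M (pot S)"
    by (rule integrable_const_bound[of _ 1]) (auto simp: abs_pot_le pot_measurable)
  show "integrable M (\<lambda>\<xi>. (pot S \<xi>)\<^sup>2)"
    by (rule integrable_const_bound[of _ 1]) (auto simp: abs_square_le_1 abs_pot_le intro!: borel_measurable_power pot_measurable)
qed

lemma rv_Phi: "rv (Phi S) M $ 1 = expectation (pot S)" "rv (Phi S) M $ 2 = expectation (\<lambda>\<xi>. (pot S \<xi>)\<^sup>2)"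
  by (simp_all add: rv_def Phi_def)

lemma rv_Phi_quadratic:
  "expectation (\<lambda>\<xi>. \<alpha> * pot S \<xi> + \<beta> * (pot S \<xi>)\<^sup>2 + \<gamma>) = \<alpha> * rv (Phi S) M $ 1 + \<beta> * rv (Phi S) M $ 2 + \<gamma>"
  by (simp add: rv_Phi integrable_pot prob_space)

lemma run_event: "run k \<inter> space M \<in> events"
proof (rule event_depends_on[of "k + 1"])
  show "depends_on (k + 1) (\<lambda>\<xi>. \<xi> \<in> run k)"
    unfolding depends_on_def run_def by (auto simp: less_Suc_eq_le)
qed

text \<open>The first \<open>k + 1\<close> preimages of \<open>run k\<close> are disjoint and have the same measure.\<close>

lemma prob_run: "prob (run k \<inter> space M) \<le> 1 / (real k + 1)"
proof -
  let ?A = "\<lambda>i. (shift ^^ i) -` (run k \<inter> space M) \<inter> space M"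
  have ev: "?A i \<in> events" for i using measurable_sets[OF funpow_measurable run_event] .
  have "disjoint_family_on ?A {..k}"
    unfolding disjoint_family_on_def
  proof (intro ballI impI)
    have False if "i < j" "j \<le> k" "\<xi> \<in> ?A i" "\<xi> \<in> ?A j" for i j \<xi>
    proof -
      have run: "(shift ^^ i) \<xi> \<in> run k" "(shift ^^ j) \<xi> \<in> run k" using that by simp_all
      have "1 \<le> j - i" "j - i \<le> k" using that(1,2) by simp_all
      with run(1) have "(shift ^^ i) \<xi> (j - i) = 2" unfolding run_def by blast
      moreover have "(shift ^^ j) \<xi> 0 = 1" using run(2) unfolding run_def by blast
      ultimately show False using that(1) by (simp add: shift_funpow)
    qed
    then show "?A i \<inter> ?A j = {}" if "i \<in> {..k}" "j \<in> {..k}" "i \<noteq> j" for i j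
      using that by (cases i j rule: linorder_cases) blast+
  qed
  then have "prob (\<Union>i\<le>k. ?A i) = (\<Sum>i\<le>k. prob (?A i))"
    using ev by (intro finite_measure_finite_Union) auto
  also have "\<dots> = (real k + 1) * prob (run k \<inter> space M)"
    unfolding measure_funpow[OF run_event] by simp
  finally have "(real k + 1) * prob (run k \<inter> space M) \<le> 1" using prob_le_1 by metis
  then show ?thesis by (simp add: field_simps)
qed

text \<open>Markov's inequality: on levels up to \<open>k\<close> the square of the potential is at
  least \<open>(1/4)^k\<close>. Any other sequence with first symbol 0 or 1 lies in
  \<open>run (k + 1)\<close>, whose mass \<open>prob_run\<close> bounds.\<close>

lemma prob_low_symbol:
  assumes "{..k} \<subseteq> S"
  shows "prob {\<xi>\<in>space M. \<xi> 0 \<le> 1} \<le> 4 ^ k * rv (Phi S) M $ 2 + 1 / (real k + 2)"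
proof -
  have low: "{\<xi>\<in>space M. \<xi> 0 \<le> 1} \<in> events"
  proof -
    have "{\<xi>\<in>space M. \<xi> 0 \<le> 1} = symbol -` {..1} \<inter> space M" by auto
    then show ?thesis using simple_functionD(2)[OF simple_symbol] by metis
  qed
  let ?R = "run (k + 1) \<inter> space M"
  have "prob {\<xi>\<in>space M. \<xi> 0 \<le> 1} = expectation (indicator {\<xi>\<in>space M. \<xi> 0 \<le> 1})"
    using low by simp
  also have "\<dots> \<le> expectation (\<lambda>\<xi>. 4 ^ k * (pot S \<xi>)\<^sup>2 + indicator ?R \<xi>)"
  proof (rule integral_mono)
    show "integrable M (indicator {\<xi>\<in>space M. \<xi> 0 \<le> 1} :: _ \<Rightarrow> real)"
      using low by (intro integrable_real_indicator) (auto simp: less_top[symmetric])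
    show "integrable M (\<lambda>\<xi>. 4 ^ k * (pot S \<xi>)\<^sup>2 + indicator ?R \<xi>)"
      using run_event by (intro Bochner_Integration.integrable_add integrable_mult_right integrable_pot integrable_real_indicator)
        (auto simp: less_top[symmetric])
    fix \<xi> assume \<xi>: "\<xi> \<in> space M"
    show "indicator {\<xi>\<in>space M. \<xi> 0 \<le> 1} \<xi> \<le> 4 ^ k * (pot S \<xi>)\<^sup>2 + indicator ?R \<xi>"
    proof (cases "\<xi> 0 \<le> 1 \<and> \<xi> \<notin> run (k + 1)")
      case True
      then obtain m where m: "m \<le> k" "\<xi> \<in> level m" using low_symbol_cases by blast
      then have "m \<in> S" using assms by auto
      have "(pot S \<xi>)\<^sup>2 = \<bar>node m\<bar>\<^sup>2" using pot_level[OF m(2), of S] \<open>m \<in> S\<close> by simp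
      also have "\<dots> = (1/4) ^ m" unfolding abs_node by (simp add: power_mult[symmetric] power2_eq_square power_mult_distrib[symmetric])
      also have "\<dots> \<ge> (1/4) ^ k" using m(1) by (intro power_decreasing) auto
      finally have "4 ^ k * (1/4) ^ k \<le> 4 ^ k * (pot S \<xi>)\<^sup>2" by (intro mult_left_mono) auto
      then have "1 \<le> 4 ^ k * (pot S \<xi>)\<^sup>2" by (simp add: power_mult_distrib[symmetric])
      then show ?thesis by (simp add: indicator_def)
    next
      case False
      then show ?thesis using \<xi> by (auto simp: indicator_def)
    qed
  qed
  also have "\<dots> = 4 ^ k * rv (Phi S) M $ 2 + prob ?R"
    using run_event[of "k + 1"] by (subst Bochner_Integration.integral_add)
      (auto simp: rv_Phi integrable_pot less_top[symmetric] intro!: integrable_real_indicator)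
  also have "prob ?R \<le> 1 / (real k + 2)" using prob_run[of "k + 1"] by (simp add: add.commute)
  finally show ?thesis by simp
qed

text \<open>The variance of the potential about \<open>node n\<close> can be read off the rotation
  vector and is 0, so almost every point lies in \<open>level n\<close>. For
  \<open>n \<ge> 1\<close> such a point starts with 2 or with a 1 followed by \<open>n\<close>
  symbols 2, and the latter is rare by \<open>prob_run\<close>.\<close>

lemma ks_entropy_node:
  assumes "rv (Phi S) M = parab (node n)" "n \<ge> 1" "n \<in> S"
  shows "ks_entropy M shift \<le> ereal (1 / (real n + 1) + 2 * sqrt (1 / (real n + 1)))"
proof -
  have "expectation (\<lambda>\<xi>. (- 2 * node n) * pot S \<xi> + 1 * (pot S \<xi>)\<^sup>2 + (node n)\<^sup>2) = 0"
    unfolding rv_Phi_quadratic assms(1) by (simp add: power2_eq_square)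
  moreover have "(- 2 * node n) * pot S \<xi> + 1 * (pot S \<xi>)\<^sup>2 + (node n)\<^sup>2 = (pot S \<xi> - node n)\<^sup>2" for \<xi>
    by (simp add: power2_eq_square algebra_simps)
  ultimately have "expectation (\<lambda>\<xi>. (pot S \<xi> - node n)\<^sup>2) = 0" by simp
  moreover have "integrable M (\<lambda>\<xi>. (pot S \<xi> - node n)\<^sup>2)"
    using integrable_pot[of S] by (auto simp: power2_diff)
  ultimately have "AE \<xi> in M. (pot S \<xi> - node n)\<^sup>2 = 0"
    using integral_nonneg_eq_0_iff_AE[of M "\<lambda>\<xi>. (pot S \<xi> - node n)\<^sup>2"] by simp
  then have AE: "AE \<xi> in M. \<xi> \<in> level n"
  proof eventually_elim
    case (elim \<xi>)
    then have eq: "pot S \<xi> = node n" by simp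
    have n0: "node n \<noteq> 0" by (simp add: node_def)
    obtain m where m: "\<xi> \<in> level m" using eq n0 pot_outside[of \<xi> S] by metis
    with eq n0 have "node m = node n" using pot_level[OF m, of S] by (auto split: if_splits)
    then show ?case using m inj_node by (metis injD)
  qed
  have null: "law M symbol a = 0" if "AE \<xi> in M. \<xi> 0 \<noteq> a" for a
    unfolding law_def using simple_functionD(2)[OF simple_symbol, of "{a}"] that
    by (subst prob_eq_0) (auto elim: eventually_mono)
  have sym: "\<xi> 0 = 1 \<and> \<xi> \<in> run n \<or> \<xi> 0 = 2" if level: "\<xi> \<in> level n" for \<xi>
  proof -
    obtain j where j: "\<forall>i<j. \<xi> i = 2" "\<xi> j = 1" "\<forall>i. j < i \<and> i \<le> j + n \<longrightarrow> \<xi> i = 2"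
      using level assms(2) unfolding level_def block_def by auto
    then show ?thesis by (cases j) (auto simp: run_def)
  qed
  show ?thesis
  proof (rule ks_entropy_le_single)
    show "law M symbol 0 = 0" "law M symbol 3 = 0"
      by (rule null, use AE in eventually_elim, drule sym, fastforce)+
    have "law M symbol 1 \<le> prob (run n \<inter> space M)"
      unfolding law_def
    proof (rule finite_measure_mono_AE[OF _ run_event])
      show "AE \<xi> in M. \<xi> \<in> symbol -` {1} \<inter> space M \<longrightarrow> \<xi> \<in> run n \<inter> space M"
        using AE by eventually_elim (auto dest!: sym)
    qed
    then show "law M symbol 1 \<le> 1 / (real n + 1)" using prob_run[of n] by simp
  qed
qed

end

section \<open>Periodic, coin-tossing and mixed measures\<close>

lemma measurable_into_shift_space:
  assumes "\<And>\<omega>. \<omega> \<in> space N \<Longrightarrow> \<phi> \<omega> \<in> shift_space"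
    and "\<And>k. (\<lambda>\<omega>. \<phi> \<omega> k) \<in> measurable N (count_space UNIV)"
  shows "\<phi> \<in> measurable N (restrict_space borel shift_space)"
proof (rule measurable_restrict_space2)
  show "\<phi> \<in> space N \<rightarrow> shift_space" using assms(1) by blast
  show "\<phi> \<in> borel_measurable N"
    by (rule measurable_coordinatewise_then_product) (metis assms(2) sets_borel_eq_count_space measurable_cong_sets)
qed

lemma shift_measurable_space: "shift \<in> measurable (restrict_space borel shift_space) (restrict_space borel shift_space)"
proof (rule measurable_into_shift_space)
  show "shift \<xi> \<in> shift_space" if "\<xi> \<in> space (restrict_space borel shift_space)" for \<xi>
    using that by (simp add: space_restrict_space shift_space_def shift_def)
  have "(\<lambda>\<xi> :: nat \<Rightarrow> nat. \<xi> (Suc k)) \<in> measurable borel borel" for k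
    by (rule measurable_product_coordinates)
  then have "(\<lambda>\<xi> :: nat \<Rightarrow> nat. \<xi> (Suc k)) \<in> measurable borel (count_space UNIV)" for k
    by (metis measurable_cong_sets sets_borel_eq_count_space)
  then show "(\<lambda>\<xi>. shift \<xi> k) \<in> measurable (restrict_space borel shift_space) (count_space UNIV)" for k
    unfolding shift_def by (rule measurable_restrict_space1)
qed

text \<open>\<open>\<phi>\<close> intertwines \<open>s\<close> with the shift, so invariance passes
  to the image measure. It serves both the rotation of residues and the shift of coin
  sequences.\<close>

lemma distr_in_invariant_measures:
  assumes N: "prob_space N" and \<phi>: "\<phi> \<in> measurable N (restrict_space borel shift_space)"
    and s: "s \<in> measurable N N" "distr N N s = N" "\<And>\<omega>. shift (\<phi> \<omega>) = \<phi> (s \<omega>)"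
  shows "distr N (restrict_space borel shift_space) \<phi> \<in> invariant_measures"
proof -
  let ?B = "restrict_space borel shift_space"
  have "distr (distr N ?B \<phi>) ?B shift = distr N ?B (\<lambda>\<omega>. shift (\<phi> \<omega>))"
    using distr_distr[OF shift_measurable_space \<phi>] by (simp add: comp_def)
  also have "\<dots> = distr (distr N N s) ?B \<phi>"
    using distr_distr[OF \<phi> s(1)] by (simp add: comp_def s(3))
  finally have "distr (distr N ?B \<phi>) ?B shift = distr N ?B \<phi>" by (simp add: s(2))
  moreover have "distr (distr N ?B \<phi>) (distr N ?B \<phi>) shift = distr (distr N ?B \<phi>) ?B shift"
    by (rule distr_cong) simp_all
  moreover have "shift \<in> measurable (distr N ?B \<phi>) (distr N ?B \<phi>)"
    using shift_measurable_space by simp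
  ultimately show ?thesis
    unfolding invariant_measures_def using prob_space.prob_space_distr[OF N \<phi>] by simp
qed

definition periodic :: "nat \<Rightarrow> nat \<Rightarrow> nat \<Rightarrow> nat" where
  "periodic m i = (\<lambda>k. if (i + k) mod (m + 1) = 0 then 1 else 2)"

lemma periodic_level: "periodic m i \<in> level m"
proof -
  \<comment> \<open>\<open>m\<close> is -1 modulo \<open>m + 1\<close>, so \<open>j\<close> is the
    residue of \<open>- i\<close>: the first position holding a 1.\<close>
  define j where "j = (m * i) mod (m + 1)"
  have "j \<le> m" by (simp add: j_def less_Suc_eq_le[symmetric])
  have "(i + j) mod (m + 1) = (i + m * i) mod (m + 1)" unfolding j_def by (rule mod_add_right_eq)
  also have "i + m * i = i * (m + 1)" by simp
  also have "i * (m + 1) mod (m + 1) = 0" by (rule mod_mult_self2_is_0)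
  finally have j: "m + 1 dvd i + j" by (rule mod_0_imp_dvd)
  have unique: "l = j" if "m + 1 dvd i + l" "l \<le> j + m" for l
  proof (rule ccontr)
    assume "l \<noteq> j"
    \<comment> \<open>Subtraction of naturals truncates, so both differences are formed: one is 0,
      the other is positive and at most \<open>m\<close>.\<close>
    have "m + 1 dvd (i + l) - (i + j)" "m + 1 dvd (i + j) - (i + l)"
      by (rule dvd_diff_nat[OF that(1) j] dvd_diff_nat[OF j that(1)])+
    then have "m + 1 dvd l - j" "m + 1 dvd j - l" by simp_all
    then show False using \<open>l \<noteq> j\<close> that(2) \<open>j \<le> m\<close>
      by (cases "l < j") (auto dest!: dvd_imp_le)
  qed
  have "m + 1 dvd i + (j + m + 1)" using dvd_add[OF j dvd_refl] by (simp add: add.assoc)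
  with j have "periodic m i j = 1" "periodic m i (j + m + 1) \<noteq> 2"
    by (simp_all add: periodic_def)
  moreover have "periodic m i l = 2" if "l \<noteq> j" "l \<le> j + m" for l
  proof -
    have "\<not> m + 1 dvd i + l" using unique that by blast
    then show ?thesis by (simp add: periodic_def dvd_eq_mod_eq_0)
  qed
  ultimately have "block m j (periodic m i)" by (simp add: block_def)
  with \<open>j \<le> m\<close> show ?thesis unfolding level_def by blast
qed

lemma parab_node_in_Rot: "m \<in> S \<Longrightarrow> parab (node m) \<in> Rot (Phi S)"
proof -
  assume m: "m \<in> S"
  let ?N = "measure_pmf (pmf_of_set {..m})" and ?B = "restrict_space borel shift_space"
  let ?s = "\<lambda>i. (i + 1) mod (m + 1)"
  have meas: "periodic m \<in> measurable ?N ?B"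
    by (rule measurable_into_shift_space) (auto simp: periodic_def shift_space_def)
  have inj: "inj_on ?s {..m}"
    by (rule inj_onI) (simp add: mod_Suc le_imp_less_Suc split: if_splits)
  have img: "?s ` {..m} = {..m}"
  proof (rule card_subset_eq)
    show "card (?s ` {..m}) = card {..m}" by (rule card_image[OF inj])
  qed (auto simp: less_Suc_eq_le[symmetric])
  have "map_pmf ?s (pmf_of_set {..m}) = pmf_of_set {..m}"
    using map_pmf_of_set_inj[OF inj] img by auto
  then have s: "distr ?N ?N ?s = ?N"
    by (metis distr_cong map_pmf_rep_eq sets_measure_pmf_count_space)
  have inv: "distr ?N ?B (periodic m) \<in> invariant_measures"
  proof (rule distr_in_invariant_measures[OF _ meas _ s])
    show "shift (periodic m i) = periodic m (?s i)" for i
      by (simp add: shift_def periodic_def mod_simps)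
  qed (simp_all add: measure_pmf.prob_space_axioms)
  interpret shift_invariant "distr ?N ?B (periodic m)" by standard (rule inv)
  have pot: "pot S (periodic m i) = node m" for i
    using pot_level[OF periodic_level] m by simp
  have "pot S \<in> borel_measurable ?B"
    by (rule borel_measurable_continuous_on_restrict[OF pot_continuous])
  then have "rv (Phi S) (distr ?N ?B (periodic m)) = parab (node m)"
    unfolding vec_eq_iff forall_2 rv_Phi by (simp add: integral_distr[OF meas] pot)
  then show ?thesis unfolding Rot_def using inv by (metis imageI)
qed

section \<open>The coin-tossing measure on the symbols 2 and 3\<close>

definition coin_seq :: "(nat \<Rightarrow> bool) measure" where
  "coin_seq = PiM UNIV (\<lambda>_. measure_pmf (bernoulli_pmf (1/2)))"

definition coin_code :: "(nat \<Rightarrow> bool) \<Rightarrow> nat \<Rightarrow> nat" where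
  "coin_code \<omega> k = (if \<omega> k then 3 else 2)"

definition coin_measure :: "(nat \<Rightarrow> nat) measure" where
  "coin_measure = distr coin_seq (restrict_space borel shift_space) coin_code"

interpretation coin: product_prob_space "\<lambda>_. measure_pmf (bernoulli_pmf (1/2))" "UNIV :: nat set"
  by standard

lemma prob_space_coin_seq: "prob_space coin_seq"
  unfolding coin_seq_def by (rule coin.prob_space_axioms)

lemma coin_code_measurable: "coin_code \<in> measurable coin_seq (restrict_space borel shift_space)"
proof (rule measurable_into_shift_space)
  show "coin_code \<omega> \<in> shift_space" for \<omega> by (simp add: coin_code_def shift_space_def)
  show "(\<lambda>\<omega>. coin_code \<omega> k) \<in> measurable coin_seq (count_space UNIV)" for k
    unfolding coin_code_def coin_seq_def
    by (rule measurable_compose[where f="\<lambda>\<omega>. \<omega> k" and g="\<lambda>b. if b then 3 else 2", OF measurable_component_singleton]) auto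
qed

lemma coin_measure_invariant: "coin_measure \<in> invariant_measures"
  unfolding coin_measure_def
proof (rule distr_in_invariant_measures[OF prob_space_coin_seq coin_code_measurable])
  have "distr (PiM UNIV (\<lambda>_. measure_pmf (bernoulli_pmf (1/2)))) (PiM UNIV ((\<lambda>_. measure_pmf (bernoulli_pmf (1/2))) \<circ> Suc))
      (\<lambda>\<omega>. \<lambda>n\<in>UNIV. \<omega> (Suc n)) = PiM UNIV ((\<lambda>_. measure_pmf (bernoulli_pmf (1/2))) \<circ> Suc)"
    using distr_PiM_reindex[of UNIV "\<lambda>_. measure_pmf (bernoulli_pmf (1/2))" Suc UNIV]
    by (simp add: measure_pmf.prob_space_axioms)
  then show "distr coin_seq coin_seq (\<lambda>\<omega> k. \<omega> (Suc k)) = coin_seq"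
    by (simp add: coin_seq_def comp_def restrict_def)
  show "(\<lambda>\<omega> k. \<omega> (Suc k)) \<in> measurable coin_seq coin_seq"
    unfolding coin_seq_def by (rule measurable_PiM_single') (auto simp: space_PiM)
  show "shift (coin_code \<omega>) = coin_code (\<lambda>k. \<omega> (Suc k))" for \<omega>
    by (simp add: coin_code_def shift_def fun_eq_iff)
qed

interpretation coin_measure: shift_invariant coin_measure
  by standard (rule coin_measure_invariant)

lemma coin_law_itinerary:
  "law coin_measure (itinerary (\<lambda>\<xi>. \<xi> 0) shift n) z =
     (if z \<in> {..<n} \<rightarrow>\<^sub>E {2, 3} then (1/2) ^ n else 0)"
proof -
  let ?I = "itinerary (\<lambda>\<xi> :: nat \<Rightarrow> nat. \<xi> 0) shift n"
  have nth: "?I (coin_code \<omega>) i = coin_code \<omega> i" if "i < n" for i \<omega>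
    using that by (simp add: shift_funpow)
  have space: "space coin_seq = UNIV" by (simp add: coin_seq_def space_PiM)
  have "law coin_measure ?I z = measure coin_seq {\<omega>. ?I (coin_code \<omega>) = z}"
  proof -
    have "?I -` {z} \<inter> space coin_measure \<in> sets coin_measure"
      by (rule simple_functionD(2)[OF coin_measure.simple_itinerary[OF coin_measure.simple_symbol]])
    then have "?I -` {z} \<inter> space coin_measure \<in> sets (restrict_space borel shift_space)"
      by (simp only: coin_measure.sets_M)
    from measure_distr[OF coin_code_measurable this]
    have "law coin_measure ?I z = measure coin_seq (coin_code -` (?I -` {z} \<inter> space coin_measure) \<inter> space coin_seq)"
      unfolding law_def coin_measure_def[symmetric] .
    also have "coin_code -` (?I -` {z} \<inter> space coin_measure) \<inter> space coin_seq = {\<omega>. ?I (coin_code \<omega>) = z}"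
      using measurable_space[OF coin_code_measurable] by (auto simp: space coin_measure_def)
    finally show ?thesis .
  qed
  also have "\<dots> = (if z \<in> {..<n} \<rightarrow>\<^sub>E {2, 3} then (1/2) ^ n else 0)"
  proof (cases "z \<in> {..<n} \<rightarrow>\<^sub>E {2, 3}")
    case True
    have eq: "?I (coin_code \<omega>) = z \<longleftrightarrow> (\<forall>i<n. \<omega> i = (z i = 3))" for \<omega>
    proof -
      have "?I (coin_code \<omega>) = z \<longleftrightarrow> (\<forall>i<n. coin_code \<omega> i = z i)"
        using True nth by (auto simp: itinerary_def fun_eq_iff PiE_def extensional_def restrict_def)
      also have "\<dots> \<longleftrightarrow> (\<forall>i<n. \<omega> i = (z i = 3))"
      proof (intro all_cong)
        fix i assume "i < n"
        then have "z i = 2 \<or> z i = 3" using True by (auto simp: PiE_def Pi_def)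
        then show "coin_code \<omega> i = z i \<longleftrightarrow> \<omega> i = (z i = 3)" by (auto simp: coin_code_def)
      qed
      finally show ?thesis .
    qed
    have "prod_emb UNIV (\<lambda>_. measure_pmf (bernoulli_pmf (1/2))) {..<n} (\<Pi>\<^sub>E i\<in>{..<n}. {z i = 3}) =
        {\<omega>. ?I (coin_code \<omega>) = z}"
      unfolding eq by (rule set_eqI) (simp add: prod_emb_def PiE_iff Ball_def)
    then have "measure coin_seq {\<omega>. ?I (coin_code \<omega>) = z} =
        (\<Prod>i<n. measure (measure_pmf (bernoulli_pmf (1/2))) {z i = 3})"
      using coin.measure_PiM_emb[of "{..<n}" "\<lambda>i. {z i = 3}"] by (simp add: coin_seq_def)
    also have "\<dots> = (1/2) ^ n" by (simp add: measure_pmf_single)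
    finally show ?thesis using True by simp
  next
    case False
    have "?I (coin_code \<omega>) \<in> {..<n} \<rightarrow>\<^sub>E {2, 3}" for \<omega>
      using nth by (auto simp: PiE_iff coin_code_def extensional_def itinerary_def)
    with False have "{\<omega>. ?I (coin_code \<omega>) = z} = {}" by blast
    with False show ?thesis by simp
  qed
  finally show ?thesis .
qed

text \<open>All \<open>2^n\<close> names over \<open>{2, 3}\<close> are equally likely, so the
  entropy of the itinerary is exactly \<open>n ln 2\<close>.\<close>

lemma ks_entropy_coin_measure: "ks_entropy coin_measure shift \<ge> ereal (ln 2)"
proof -
  let ?I = "itinerary (\<lambda>\<xi>. \<xi> 0 :: nat) shift"
  have ent: "ent coin_measure (?I n) = real n * ln 2" for n
  proof -
    let ?p = "law coin_measure (?I n)"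
    have S: "simple_function coin_measure (?I n)"
      by (intro coin_measure.simple_itinerary coin_measure.simple_symbol)
    have "ent coin_measure (?I n) = - (\<Sum>z\<in>?I n ` space coin_measure. ?p z * (- real n * ln 2))"
      unfolding ent_def
      by (intro arg_cong[where f=uminus] sum.cong refl) (simp add: coin_law_itinerary ln_realpow ln_div)
    also have "\<dots> = real n * ln 2 * (\<Sum>z\<in>?I n ` space coin_measure. ?p z)"
      by (simp add: sum_distrib_left sum_negf mult_ac)
    finally show ?thesis using coin_measure.sum_law[OF S] by simp
  qed
  have "(\<lambda>n. ent coin_measure (?I n) / real n) \<longlonglongrightarrow> ln 2"
    by (rule tendsto_eventually) (auto simp: ent intro: eventually_mono[OF eventually_gt_at_top[of 0]])
  then have "entropy_wrt coin_measure shift (fibres coin_measure (\<lambda>\<xi>. \<xi> 0)) = ln 2"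
    using coin_measure.entropy_wrt_fibres_LIMSEQ[OF coin_measure.simple_symbol] LIMSEQ_unique by blast
  then show ?thesis
    using coin_measure.entropy_wrt_fibres_le_ks_entropy[OF coin_measure.simple_symbol] by simp
qed

lemma rv_coin_measure: "rv (Phi S) coin_measure = 0"
proof -
  have "coin_code \<omega> \<notin> level m" for \<omega> m
  proof
    assume "coin_code \<omega> \<in> level m"
    then have "coin_code \<omega> 0 = 0 \<or> (\<exists>j. coin_code \<omega> j = 1)" by (auto simp: level_def block_def)
    then show False by (auto simp: coin_code_def split: if_splits)
  qed
  then have pot: "pot S (coin_code \<omega>) = 0" for \<omega> by (rule pot_outside)
  have "pot S \<in> borel_measurable (restrict_space borel shift_space)"
    by (rule borel_measurable_continuous_on_restrict[OF pot_continuous])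
  then show ?thesis
    unfolding vec_eq_iff forall_2 coin_measure.rv_Phi
    by (simp add: coin_measure_def integral_distr[OF coin_code_measurable] pot)
qed

text \<open>A Bernoulli trial with parameter \<open>u\<close> chooses between the two measures. The
  resulting mixture is invariant, and integrals against it combine linearly.\<close>

lemma Rot_convex: "convex (Rot (Phi S))"
proof (rule convexI)
  fix x y :: "real^2" and u v :: real
  assume "x \<in> Rot (Phi S)" "y \<in> Rot (Phi S)" and uv: "0 \<le> u" "0 \<le> v" "u + v = 1"
  then obtain \<mu> \<nu> where \<mu>: "\<mu> \<in> invariant_measures" "x = rv (Phi S) \<mu>"
    and \<nu>: "\<nu> \<in> invariant_measures" "y = rv (Phi S) \<nu>" by (auto simp: Rot_def)
  interpret m: shift_invariant \<mu> by standard (rule \<mu>)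
  interpret n: shift_invariant \<nu> by standard (rule \<nu>)
  let ?B = "restrict_space borel shift_space :: (nat \<Rightarrow> nat) measure"
  let ?p = "measure_pmf (bernoulli_pmf u)" and ?f = "\<lambda>b. if b then \<mu> else \<nu>"
  define mix where "mix = ?p \<bind> ?f"
  have f: "?f \<in> measurable ?p (subprob_algebra ?B)"
    using m.prob_space_axioms n.prob_space_axioms
    by (auto simp: space_subprob_algebra m.sets_M n.sets_M prob_space_imp_subprob_space)
  have sets_mix: "sets mix = sets ?B"
    unfolding mix_def by (rule sets_bind) (auto simp: m.sets_M n.sets_M)
  have em: "emeasure mix A = emeasure \<mu> A * u + emeasure \<nu> A * (1 - u)" if "A \<in> sets ?B" for A
  proof -
    have "emeasure mix A = (\<integral>\<^sup>+ b. emeasure (?f b) A \<partial>?p)"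
      unfolding mix_def by (rule emeasure_bind[OF _ f that]) simp
    also have "\<dots> = emeasure \<mu> A * u + emeasure \<nu> A * (1 - u)"
      using uv by (subst nn_integral_bernoulli_pmf) auto
    finally show ?thesis .
  qed
  have "prob_space mix" unfolding mix_def
    by (rule prob_space.prob_space_bind[OF measure_pmf.prob_space_axioms _ f])
      (simp add: m.prob_space_axioms n.prob_space_axioms)
  have shift_meas: "shift \<in> measurable mix mix"
    using shift_measurable_space by (simp add: measurable_cong_sets[OF sets_mix sets_mix])
  have "distr mix mix shift = mix"
  proof (rule measure_eqI)
    fix A assume "A \<in> sets (distr mix mix shift)"
    then have A: "A \<in> sets mix" by simp
    have pre: "emeasure (distr \<rho> \<rho> shift) A = emeasure \<rho> (shift -` A \<inter> shift_space)"
      if "shift_invariant \<rho>" for \<rho>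
    proof -
      interpret r: shift_invariant \<rho> by (rule that)
      show ?thesis using A by (subst emeasure_distr[OF r.T_measurable]) (simp_all add: r.sets_M sets_mix r.space_M)
    qed
    have space: "space mix = shift_space"
      using sets_eq_imp_space_eq[OF sets_mix] by (simp add: space_restrict_space)
    have "emeasure (distr mix mix shift) A = emeasure mix (shift -` A \<inter> shift_space)"
      using emeasure_distr[OF shift_meas A] by (simp add: space)
    also have "\<dots> = emeasure \<mu> (shift -` A \<inter> shift_space) * u + emeasure \<nu> (shift -` A \<inter> shift_space) * (1 - u)"
      using measurable_sets[OF shift_meas A] by (intro em) (simp add: space sets_mix)
    also have "\<dots> = emeasure mix A"
      using A pre[OF m.shift_invariant_axioms] pre[OF n.shift_invariant_axioms]
      by (simp add: m.T_distr n.T_distr em sets_mix)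
    finally show "emeasure (distr mix mix shift) A = emeasure mix A" .
  qed simp
  with \<open>prob_space mix\<close> shift_meas have inv: "mix \<in> invariant_measures"
    unfolding invariant_measures_def using sets_mix by simp
  interpret mix: shift_invariant mix by standard (rule inv)
  have expect: "integral\<^sup>L mix g = u * integral\<^sup>L \<mu> g + v * integral\<^sup>L \<nu> g"
    if g: "g \<in> borel_measurable ?B" "\<And>\<xi>. \<bar>g \<xi>\<bar> \<le> 1" for g
  proof -
    have "integral\<^sup>L mix g = (\<integral>b. integral\<^sup>L (?f b) g \<partial>?p)"
      unfolding mix_def
      by (rule integral_bind[OF g(1) g(2) f measure_pmf.finite_measure, of 1])
        (simp add: m.emeasure_space_1 n.emeasure_space_1)
    also have "\<dots> = integral\<^sup>L \<mu> g * u + integral\<^sup>L \<nu> g * (1 - u)"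
      using uv by (subst integral_bernoulli_pmf) auto
    also have "1 - u = v" using uv by simp
    finally show ?thesis by (simp add: mult.commute)
  qed
  have meas: "pot S \<in> borel_measurable ?B"
    by (rule borel_measurable_continuous_on_restrict[OF pot_continuous])
  have "rv (Phi S) mix = u *\<^sub>R x + v *\<^sub>R y"
    unfolding \<mu>(2) \<nu>(2) vec_eq_iff forall_2 mix.rv_Phi
    using expect[OF meas abs_pot_le] expect[of "\<lambda>\<xi>. (pot S \<xi>)\<^sup>2"] meas abs_pot_le
    by (simp add: m.rv_Phi n.rv_Phi abs_square_le_1)
  then show "u *\<^sub>R x + v *\<^sub>R y \<in> Rot (Phi S)" unfolding Rot_def using inv by (metis imageI)
qed

section \<open>Localized entropy near the origin\<close>

lemma zero_in_Rot: "0 \<in> Rot (Phi S)"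
  unfolding Rot_def using coin_measure_invariant rv_coin_measure by (metis imageI)

interpretation Rot: node_polygon "Rot (Phi UNIV)"
proof
  show "convex (Rot (Phi UNIV))" by (rule Rot_convex)
  show "parab t \<in> Rot (Phi UNIV)" if "t \<in> nodes" for t
    using that parab_node_in_Rot[of _ UNIV] zero_in_Rot by auto
  fix p :: "real^2" and \<alpha> \<beta> \<gamma> :: real
  assume "p \<in> Rot (Phi UNIV)" and nonneg: "\<And>t. t \<in> nodes \<Longrightarrow> \<alpha> * t + \<beta> * t\<^sup>2 + \<gamma> \<ge> 0"
  then obtain \<mu> where \<mu>: "\<mu> \<in> invariant_measures" "p = rv (Phi UNIV) \<mu>" by (auto simp: Rot_def)
  interpret shift_invariant \<mu> by standard (rule \<mu>)
  have "0 \<le> (\<integral>\<xi>. \<alpha> * pot UNIV \<xi> + \<beta> * (pot UNIV \<xi>)\<^sup>2 + \<gamma> \<partial>\<mu>)"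
    by (rule Bochner_Integration.integral_nonneg) (rule nonneg[OF pot_in_nodes])
  then show "0 \<le> \<alpha> * p $ 1 + \<beta> * p $ 2 + \<gamma>" unfolding rv_Phi_quadratic \<mu>(2) .
qed

text \<open>Membership in the rotation set supplies a measure; over an empty family the supremum in
  \<open>ereal\<close> would be \<open>-\<infinity>\<close>.\<close>

lemma loc_entropy_nonneg:
  assumes "w \<in> Rot \<Psi>" shows "loc_entropy \<Psi> w \<ge> 0"
proof -
  obtain \<mu> where \<mu>: "\<mu> \<in> invariant_measures" "w = rv \<Psi> \<mu>" using assms by (auto simp: Rot_def)
  interpret shift_invariant \<mu> by standard (rule \<mu>)
  show ?thesis unfolding loc_entropy_def using ks_entropy_nonneg \<mu> by (intro SUP_upper2[of \<mu>]) auto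
qed

lemma loc_entropy_zero_ge: "loc_entropy (Phi S) 0 \<ge> ereal (ln 2)"
  unfolding loc_entropy_def using ks_entropy_coin_measure rv_coin_measure coin_measure_invariant
  by (intro SUP_upper2[of coin_measure]) auto

text \<open>A bound on the mass of the symbols 0 and 1: the first summand accounts for levels up to
  \<open>k\<close>, the second for \<open>run (k + 1)\<close>.\<close>

definition slack :: "nat \<Rightarrow> real" where
  "slack k = 2 * (1/4) ^ k + 1 / (real k + 2)"

lemma slack_tendsto: "(\<lambda>k. ln 2 + slack k + 4 * sqrt (slack k)) \<longlonglongrightarrow> ln 2"
proof -
  have "slack \<longlonglongrightarrow> 2 * 0 + 0" unfolding slack_def
    by (intro tendsto_add tendsto_mult tendsto_const LIMSEQ_power_zero) (simp, real_asymp)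
  then have "slack \<longlonglongrightarrow> 0" by simp
  from tendsto_add[OF tendsto_add[OF tendsto_const this] tendsto_mult[OF tendsto_const tendsto_real_sqrt[OF this]], of "ln 2" 4]
  show ?thesis by simp
qed

lemma loc_entropy_le_slack:
  assumes "w \<in> cball 0 r" "{..k} \<subseteq> S" "4 ^ k * r \<le> 2 * (1/4) ^ k"
  shows "loc_entropy (Phi S) w \<le> ereal (ln 2 + slack k + 4 * sqrt (slack k))"
  unfolding loc_entropy_def
proof (rule SUP_least)
  fix \<mu> assume "\<mu> \<in> {\<mu> \<in> invariant_measures. rv (Phi S) \<mu> = w}"
  then have \<mu>: "\<mu> \<in> invariant_measures" "rv (Phi S) \<mu> = w" by auto
  interpret shift_invariant \<mu> by standard (rule \<mu>)
  show "ks_entropy \<mu> shift \<le> ereal (ln 2 + slack k + 4 * sqrt (slack k))"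
  proof (rule ks_entropy_le_ln2)
    have "w $ 2 \<le> r" using assms(1) component_le_norm_cart[of w 2] by simp
    then have "4 ^ k * w $ 2 \<le> 4 ^ k * r" by simp
    then show "prob {\<xi>\<in>space \<mu>. \<xi> 0 \<le> 1} \<le> slack k"
      using prob_low_symbol[OF assms(2)] assms(3) unfolding \<mu>(2) slack_def by linarith
  qed
qed

lemma loc_entropy_zero: "loc_entropy (Phi UNIV) 0 = ereal (ln 2)"
proof (rule antisym)
  \<comment> \<open>Radius 0 is admissible for every \<open>k\<close>, which can then tend to
    infinity.\<close>
  have "loc_entropy (Phi UNIV) 0 \<le> ereal (ln 2 + slack k + 4 * sqrt (slack k))" for k
    by (rule loc_entropy_le_slack[of _ 0]) auto
  then show "loc_entropy (Phi UNIV) 0 \<le> ereal (ln 2)"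
    by (intro LIMSEQ_le_const[OF tendsto_ereal[OF slack_tendsto]]) auto
qed (rule loc_entropy_zero_ge)

lemma upper_entropy_tendsto: "(\<lambda>n. upper_entropy (Phi {..n}) 0 (2 * (1/2) ^ n)) \<longlonglongrightarrow> ereal (ln 2)"
proof (rule tendsto_sandwich)
  have zero: "0 \<in> cball 0 (2 * (1/2) ^ n) \<inter> Rot (Phi {..n})" for n using zero_in_Rot by simp
  then have ne: "cball 0 (2 * (1/2) ^ n) \<inter> Rot (Phi {..n}) \<noteq> {}" for n by blast
  show "\<forall>\<^sub>F n in sequentially. ereal (ln 2) \<le> upper_entropy (Phi {..n}) 0 (2 * (1/2) ^ n)"
    unfolding upper_entropy_def if_not_P[OF ne]
    by (intro always_eventually allI SUP_upper2[OF zero] loc_entropy_zero_ge)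
  let ?u = "\<lambda>k. ln 2 + slack k + 4 * sqrt (slack k)"
  have "upper_entropy (Phi {..n}) 0 (2 * (1/2) ^ n) \<le> ereal (?u (n div 4))" for n
    unfolding upper_entropy_def if_not_P[OF ne]
  proof (rule SUP_least)
    fix w assume "w \<in> cball 0 (2 * (1/2) ^ n) \<inter> Rot (Phi {..n})"
    \<comment> \<open>With \<open>k = n div 4\<close> the radius is at most
      \<open>2 * (1/16)^k\<close>, which absorbs the Markov factor \<open>4^k\<close> and still
      leaves \<open>(1/4)^k\<close>. Also \<open>k \<le> n\<close>, so the levels up to
      \<open>k\<close> survive the truncation.\<close>
    moreover have "4 ^ (n div 4) * (2 * (1/2) ^ n) \<le> 2 * (1/4::real) ^ (n div 4)"
    proof -
      have "(1/2::real) ^ n \<le> (1/2) ^ (4 * (n div 4))" by (intro power_decreasing) auto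
      also have "\<dots> = (1/4) ^ (n div 4) * (1/4) ^ (n div 4)"
        by (simp add: power_mult power_mult_distrib[symmetric] power4_eq_xxxx)
      finally have "4 ^ (n div 4) * (2 * (1/2) ^ n) \<le> 4 ^ (n div 4) * (2 * ((1/4::real) ^ (n div 4) * (1/4) ^ (n div 4)))"
        by simp
      also have "\<dots> = 2 * (4 * (1/4)) ^ (n div 4) * (1/4) ^ (n div 4)" by (simp only: power_mult_distrib mult_ac)
      finally show ?thesis by simp
    qed
    ultimately show "loc_entropy (Phi {..n}) w \<le> ereal (?u (n div 4))"
      by (intro loc_entropy_le_slack[of _ "2 * (1/2) ^ n"]) auto
  qed
  then show "\<forall>\<^sub>F n in sequentially. upper_entropy (Phi {..n}) 0 (2 * (1/2) ^ n) \<le> ereal (?u (n div 4))"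
    by simp
  have "filterlim (\<lambda>n::nat. n div 4) at_top sequentially"
    unfolding filterlim_at_top eventually_sequentially
  proof
    fix Z :: nat
    have "\<forall>n\<ge>4 * Z. Z \<le> n div 4" by auto
    then show "\<exists>N. \<forall>n\<ge>N. Z \<le> n div 4" by blast
  qed
  then show "(\<lambda>n. ereal (?u (n div 4))) \<longlonglongrightarrow> ereal (ln 2)"
    by (intro tendsto_ereal filterlim_compose[OF slack_tendsto])
qed simp

lemma loc_entropy_node:
  assumes "n \<ge> 1" "n \<in> S"
  shows "loc_entropy (Phi S) (parab (node n)) \<le> ereal (1 / (real n + 1) + 2 * sqrt (1 / (real n + 1)))"
  unfolding loc_entropy_def
proof (rule SUP_least)
  fix \<mu> assume "\<mu> \<in> {\<mu> \<in> invariant_measures. rv (Phi S) \<mu> = parab (node n)}"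
  then have \<mu>: "\<mu> \<in> invariant_measures" "rv (Phi S) \<mu> = parab (node n)" by auto
  interpret shift_invariant \<mu> by standard (rule \<mu>)
  show "ks_entropy \<mu> shift \<le> ereal (1 / (real n + 1) + 2 * sqrt (1 / (real n + 1)))"
    by (rule ks_entropy_node[OF \<mu>(2) assms])
qed

lemma lower_entropy_tendsto: "(\<lambda>n. lower_entropy (Phi {..n}) 0 (2 * (1/2) ^ n)) \<longlonglongrightarrow> 0"
proof (rule tendsto_sandwich)
  have node: "parab (node n) \<in> cball 0 (2 * (1/2) ^ n) \<inter> Rot (Phi {..n})" for n
    using norm_parab_le[of "node n"] parab_node_in_Rot[of n "{..n}"] by (simp add: abs_node power_le_one)
  then have ne: "cball 0 (2 * (1/2) ^ n) \<inter> Rot (Phi {..n}) \<noteq> {}" for n by blast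
  show "\<forall>\<^sub>F n in sequentially. 0 \<le> lower_entropy (Phi {..n}) 0 (2 * (1/2) ^ n)"
    unfolding lower_entropy_def if_not_P[OF ne]
    by (intro always_eventually allI INF_greatest loc_entropy_nonneg) blast
  show "\<forall>\<^sub>F n in sequentially. lower_entropy (Phi {..n}) 0 (2 * (1/2) ^ n)
      \<le> ereal (1 / (real n + 1) + 2 * sqrt (1 / (real n + 1)))"
    using eventually_ge_at_top[of 1]
  proof eventually_elim
    case (elim n)
    show ?case unfolding lower_entropy_def if_not_P[OF ne]
      by (intro INF_lower2[OF node[of n]] loc_entropy_node elim) simp
  qed
  have "(\<lambda>n. 1 / (real n + 1) + 2 * sqrt (1 / (real n + 1))) \<longlonglongrightarrow> 0"
    by real_asymp
  then show "(\<lambda>n. ereal (1 / (real n + 1) + 2 * sqrt (1 / (real n + 1)))) \<longlonglongrightarrow> 0"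
    unfolding zero_ereal_def by (rule tendsto_ereal)
qed simp

theorem theorem7p3:
  "\<exists>(\<Phi> :: (nat \<Rightarrow> nat) \<Rightarrow> real^2) (\<epsilon> :: nat \<Rightarrow> real)
     (\<Phi>\<epsilon> :: nat \<Rightarrow> (nat \<Rightarrow> nat) \<Rightarrow> real^2) (w :: real^2).
     continuous_on shift_space \<Phi> \<and>
     (\<forall>n. \<epsilon> n > 0) \<and> \<epsilon> \<longlonglongrightarrow> 0 \<and>
     (\<forall>n. locally_constant (\<Phi>\<epsilon> n)) \<and>
     (\<forall>n. sup_norm (\<lambda>\<xi>. \<Phi> \<xi> - \<Phi>\<epsilon> n \<xi>) < \<epsilon> n) \<and>
     (\<lambda>n. sup_norm (\<lambda>\<xi>. \<Phi> \<xi> - \<Phi>\<epsilon> n \<xi>)) \<longlonglongrightarrow> 0 \<and>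
     infinite_polygon_boundary (Rot \<Phi>) \<and>
     smooth_point (Rot \<Phi>) w \<and> exposed_point (Rot \<Phi>) w \<and>
     (\<lambda>n. lower_entropy (\<Phi>\<epsilon> n) w (\<epsilon> n)) \<longlonglongrightarrow> 0 \<and>
     0 < loc_entropy \<Phi> w \<and>
     (\<lambda>n. upper_entropy (\<Phi>\<epsilon> n) w (\<epsilon> n)) \<longlonglongrightarrow> loc_entropy \<Phi> w \<and>
     loc_entropy \<Phi> w = ereal (ln 2)"
\<comment> \<open>The factor 2 in the radius makes the bound \<open>(1/2)^n\<close> on the sup norm
  strict and places the vertex \<open>parab (node n)\<close> in the closed ball about the
  origin.\<close>
proof (rule exI[of _ "Phi UNIV"], rule exI[of _ "\<lambda>n. 2 * (1/2) ^ n"],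
    rule exI[of _ "\<lambda>n. Phi {..n}"], rule exI[of _ 0], intro conjI allI)
  show "(\<lambda>n. 2 * (1/2::real) ^ n) \<longlonglongrightarrow> 0"
    using tendsto_mult_right_zero[OF LIMSEQ_power_zero[of "1/2::real"], of 2] by simp
  have "(1/2) ^ n < 2 * (1/2::real) ^ n" for n by simp
  then show "sup_norm (\<lambda>\<xi>. Phi UNIV \<xi> - Phi {..n} \<xi>) < 2 * (1/2) ^ n" for n
    using sup_norm_Phi_truncate(2) by (rule le_less_trans[rotated])
  show "(\<lambda>n. sup_norm (\<lambda>\<xi>. Phi UNIV \<xi> - Phi {..n} \<xi>)) \<longlonglongrightarrow> 0"
    by (rule tendsto_sandwich[OF _ _ tendsto_const LIMSEQ_power_zero[of "1/2::real"]])
      (simp_all add: sup_norm_Phi_truncate)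
qed (simp_all add: Phi_continuous Phi_locally_constant Rot.polygon Rot.zero_smooth Rot.zero_exposed
    loc_entropy_zero upper_entropy_tendsto lower_entropy_tendsto)

end
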